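(* Let $d>3$ be even and let $C=C(2,0,\ldots,0,2)$ be the caterpillar of diameter $d$ (so its spine has $d-1$ vertices, the two end vertices of the spine are each adjacent to exactly two vertices of degree 1, and the other spine vertices are adjacent to none). Then $\mathrm{ern}(C)=3$.
   Context: All graphs are finite, simple and undirected. An edge-card of a graph $G$ is an edge-deleted subgraph $G-e$ (all vertices are kept), considered up to isomorphism. For distinct edges $e_1,\dots,e_k$ of $G$, the edge-cards $G-e_1,\dots,G-e_k$ are said to reconstruct $G$ if every graph $H$ having distinct edges $f_1,\dots,f_k$ with $H-f_i\simeq G-e_i$ for all $i$ is isomorphic to $G$ ($H$ ranges over all graphs, not only trees). The edge-reconstruction number $\mathrm{ern}(G)$ is the least $k$ for which some $k$ edge-cards of $G$ reconstruct $G$. A caterpillar is a tree in which deleting all vertices of degree 1 leaves a path, called the spine. $C(a_1,\dots,a_s)$ denotes the caterpillar with spine the path $v_1v_2\cdots v_s$ in which $v_i$ is adjacent to exactly $a_i$ vertices of degree 1. The diameter of a tree is the number of edges of a longest path. *)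

theory Defs
  imports Main
begin

record 'v ugraph =
  verts :: "'v set"
  edges :: "'v set set"

definition simple_graph :: "'v ugraph \<Rightarrow> bool" where
  "simple_graph G \<longleftrightarrow> finite (verts G) \<and> (\<forall>e\<in>edges G. e \<subseteq> verts G \<and> card e = 2)"

definition graph_iso :: "'v ugraph \<Rightarrow> 'w ugraph \<Rightarrow> bool"  (infix "\<simeq>" 50) where
  "G \<simeq> H \<longleftrightarrow> (\<exists>\<phi>. bij_betw \<phi> (verts G) (verts H) \<and> edges H = (\<lambda>e. \<phi> ` e) ` edges G)"

definition del_edge :: "'v ugraph \<Rightarrow> 'v set \<Rightarrow> 'v ugraph" where
  "del_edge G e = \<lparr>verts = verts G, edges = edges G - {e}\<rparr>"

definition del_verts :: "'v ugraph \<Rightarrow> 'v set \<Rightarrow> 'v ugraph" where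
  "del_verts G U = \<lparr>verts = verts G - U, edges = {e \<in> edges G. e \<inter> U = {}}\<rparr>"

definition degree :: "'v ugraph \<Rightarrow> 'v \<Rightarrow> nat" where
  "degree G v = card {e \<in> edges G. v \<in> e}"

definition leaves :: "'v ugraph \<Rightarrow> 'v set" where
  "leaves G = {v \<in> verts G. degree G v = 1}"

definition is_path :: "'v ugraph \<Rightarrow> 'v list \<Rightarrow> bool" where
  "is_path G p \<longleftrightarrow> p \<noteq> [] \<and> distinct p \<and> set p \<subseteq> verts G \<and>
     (\<forall>i. Suc i < length p \<longrightarrow> {p ! i, p ! Suc i} \<in> edges G)"

definition is_cycle :: "'v ugraph \<Rightarrow> 'v list \<Rightarrow> bool" where
  "is_cycle G p \<longleftrightarrow> is_path G p \<and> length p \<ge> 3 \<and> {last p, hd p} \<in> edges G"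

definition connected_graph :: "'v ugraph \<Rightarrow> bool" where
  "connected_graph G \<longleftrightarrow> verts G \<noteq> {} \<and>
     (\<forall>u\<in>verts G. \<forall>v\<in>verts G. \<exists>p. is_path G p \<and> hd p = u \<and> last p = v)"

definition is_tree :: "'v ugraph \<Rightarrow> bool" where
  "is_tree G \<longleftrightarrow> simple_graph G \<and> connected_graph G \<and> (\<nexists>p. is_cycle G p)"

text \<open>A path with \<open>k\<close> vertices has \<open>k - 1\<close> edges.\<close>

definition tree_diameter :: "'v ugraph \<Rightarrow> nat" where
  "tree_diameter G = Max {length p - 1 | p. is_path G p}"

definition path_graph :: "'v list \<Rightarrow> 'v ugraph" where
  "path_graph vs = \<lparr>verts = set vs, edges = {{vs ! i, vs ! Suc i} | i. Suc i < length vs}\<rparr>"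

definition is_spine :: "'v ugraph \<Rightarrow> 'v list \<Rightarrow> bool" where
  "is_spine G vs \<longleftrightarrow> distinct vs \<and> del_verts G (leaves G) = path_graph vs"

text \<open>\<open>is_caterpillar G as\<close>: the graph \<open>G\<close> is (a copy of) the caterpillar
  \<open>C(a\<^sub>1, \<dots>, a\<^sub>s)\<close>, where \<open>as = [a\<^sub>1, \<dots>, a\<^sub>s]\<close>.\<close>

definition is_caterpillar :: "'v ugraph \<Rightarrow> nat list \<Rightarrow> bool" where
  "is_caterpillar G as \<longleftrightarrow> is_tree G \<and>
     (\<exists>vs. is_spine G vs \<and> length vs = length as \<and>
        (\<forall>i<length as. card {u \<in> leaves G. {vs ! i, u} \<in> edges G} = as ! i))"

text \<open>The edges \<open>e\<^sub>1, \<dots>, e\<^sub>k\<close> form the set \<open>F\<close>, and the distinct edges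
  \<open>f\<^sub>1, \<dots>, f\<^sub>k\<close> of the competing graph \<open>H\<close> are given by an injection \<open>f\<close> on \<open>F\<close>.
  Every finite graph has an isomorphic copy on natural numbers, so letting \<open>H\<close> range over
  graphs with vertices in \<^typ>\<open>nat\<close> covers all finite simple graphs.\<close>

definition edge_cards_reconstruct :: "'v ugraph \<Rightarrow> 'v set set \<Rightarrow> bool" where
  "edge_cards_reconstruct G F \<longleftrightarrow>
     (\<forall>H :: nat ugraph. \<forall>f. simple_graph H \<and> inj_on f F \<and> f ` F \<subseteq> edges H \<and>
        (\<forall>e\<in>F. del_edge H (f e) \<simeq> del_edge G e) \<longrightarrow> H \<simeq> G)"

text \<open>If not even the set of all edge-cards reconstructs \<open>G\<close>, the value is unspecified.\<close>

definition ern :: "'v ugraph \<Rightarrow> nat" where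
  "ern G = (LEAST k. \<exists>F \<subseteq> edges G. card F = k \<and> edge_cards_reconstruct G F)"

end

theory Submission imports Defs begin

text \<open>
  Let \<open>N = 2m\<close> be the number of edges. The three cards obtained by deleting one pendant edge and
  the two middle spine edges reconstruct \<open>C\<close>: the first forces a competitor to be \<open>C\<close> with one
  leaf reattached at some vertex \<open>v\<close>, since the other cards have no isolated vertex. Each of the
  other two cards falls into two parts, both with at least \<open>m\<close> vertices and with a vertex carrying
  two leaves; if \<open>v\<close> is not the original position, only one edge of the competitor has such a card.

  Two cards never suffice. Up to isomorphism a card is \<open>C - \<ell>\<close> for a pendant edge \<open>\<ell>\<close>,
  or \<open>C\<close> minus an inner spine edge in the left half, by reflection. For each pair of these (repetitions
  included) some edge exchange \<open>C - p + q\<close> has both cards: deleting \<open>q\<close> gives the first, and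
  deleting another edge \<open>r\<close> gives the second after relabelling the vertices,
  typically by reversing a segment of the spine.
\<close>

section \<open>Graph isomorphisms and their effect on edge-cards\<close>

definition is_iso :: "('v \<Rightarrow> 'w) \<Rightarrow> 'v ugraph \<Rightarrow> 'w ugraph \<Rightarrow> bool" where
  "is_iso \<phi> G H \<longleftrightarrow> bij_betw \<phi> (verts G) (verts H) \<and> edges H = (\<lambda>e. \<phi> ` e) ` edges G"

lemma graph_iso_iff: "G \<simeq> H \<longleftrightarrow> (\<exists>\<phi>. is_iso \<phi> G H)"
  by (simp add: graph_iso_def is_iso_def)

lemma graph_iso_refl: "G \<simeq> G"
  unfolding graph_iso_def by (rule exI[of _ id]) auto

lemma is_iso_comp: "is_iso \<phi> G H \<Longrightarrow> is_iso \<psi> H K \<Longrightarrow> is_iso (\<psi> \<circ> \<phi>) G K"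
  unfolding is_iso_def by (auto intro: bij_betw_trans simp: image_image image_comp)

lemma graph_iso_trans: "G \<simeq> H \<Longrightarrow> H \<simeq> K \<Longrightarrow> G \<simeq> K"
  unfolding graph_iso_iff using is_iso_comp by blast

lemma simple_graph_edge:
  assumes "simple_graph G" "e \<in> edges G"
  shows "e \<subseteq> verts G" "card e = 2"
  using assms by (auto simp: simple_graph_def)

lemma simple_graph_edgeE:
  assumes "simple_graph G" "e \<in> edges G"
  obtains a b where "e = {a, b}" "a \<noteq> b" "a \<in> verts G" "b \<in> verts G"
  using simple_graph_edge[OF assms] by (auto simp: card_2_iff)

lemma is_iso_inv:
  assumes "simple_graph G" "is_iso \<phi> G H"
  shows "is_iso (inv_into (verts G) \<phi>) H G"
proof -
  let ?\<psi> = "inv_into (verts G) \<phi>"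
  have b: "bij_betw \<phi> (verts G) (verts H)" and e: "edges H = (\<lambda>e. \<phi> ` e) ` edges G"
    using assms(2) by (auto simp: is_iso_def)
  have "?\<psi> ` \<phi> ` x = x" if "x \<in> edges G" for x
    using simple_graph_edge(1)[OF assms(1) that] b
    by (auto simp: bij_betw_def inv_into_image_cancel)
  hence "(\<lambda>e. ?\<psi> ` e) ` edges H = edges G"
    unfolding e by (simp add: image_image)
  with b show ?thesis by (simp add: is_iso_def bij_betw_inv_into)
qed

lemma graph_iso_sym: "simple_graph G \<Longrightarrow> G \<simeq> H \<Longrightarrow> H \<simeq> G"
  unfolding graph_iso_iff using is_iso_inv by blast

lemma simple_graph_del_edge: "simple_graph G \<Longrightarrow> simple_graph (del_edge G e)"
  by (auto simp: simple_graph_def del_edge_def)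

lemma is_iso_simple_graph:
  assumes "simple_graph G" "is_iso \<phi> G H"
  shows "simple_graph H"
proof -
  have b: "bij_betw \<phi> (verts G) (verts H)" and e: "edges H = (\<lambda>e. \<phi> ` e) ` edges G"
    using assms(2) by (auto simp: is_iso_def)
  have "\<phi> ` x \<subseteq> verts H \<and> card (\<phi> ` x) = 2" if "x \<in> edges G" for x
    using simple_graph_edge[OF assms(1) that] b
    by (metis bij_betw_def card_image image_mono inj_on_subset)
  moreover have "finite (verts H)"
    using b assms(1) by (auto simp: simple_graph_def bij_betw_def dest: sym)
  ultimately show ?thesis by (auto simp: simple_graph_def e)
qed

lemma inj_on_image_edges:
  assumes "simple_graph G" "is_iso \<phi> G H"
  shows "inj_on (\<lambda>e. \<phi> ` e) (edges G)"
proof (rule inj_onI)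
  fix x y assume "x \<in> edges G" "y \<in> edges G" "\<phi> ` x = \<phi> ` y"
  thus "x = y"
    using simple_graph_edge(1)[OF assms(1)] assms(2)
    by (metis bij_betw_def inj_on_image_eq_iff is_iso_def)
qed

lemma is_iso_del_edge:
  assumes "simple_graph G" "is_iso \<phi> G H" "e \<in> edges G"
  shows "is_iso \<phi> (del_edge G e) (del_edge H (\<phi> ` e))"
proof -
  have "(\<lambda>e. \<phi> ` e) ` (edges G - {e}) = edges H - {\<phi> ` e}"
    using inj_on_image_edges[OF assms(1,2)] assms(2,3)
    by (subst inj_on_image_set_diff[of _ "edges G"]) (auto simp: is_iso_def)
  with assms(2) show ?thesis by (simp add: is_iso_def del_edge_def)
qed

text \<open>A competitor for the larger set, with its edge assignment restricted, competes for the
  smaller one. The lower bound can thus be proved for sets of exactly two edges.\<close>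

lemma edge_cards_reconstruct_mono:
  assumes "edge_cards_reconstruct G F" "F \<subseteq> F'"
  shows "edge_cards_reconstruct G F'"
  unfolding edge_cards_reconstruct_def
proof (intro allI impI, elim conjE)
  fix H :: "nat ugraph" and f
  assume "simple_graph H" "inj_on f F'" "f ` F' \<subseteq> edges H"
    "\<forall>e\<in>F'. del_edge H (f e) \<simeq> del_edge G e"
  with assms(2) have "simple_graph H \<and> inj_on f F \<and> f ` F \<subseteq> edges H \<and>
    (\<forall>e\<in>F. del_edge H (f e) \<simeq> del_edge G e)"
    by (auto intro: inj_on_subset)
  with assms(1) show "H \<simeq> G" unfolding edge_cards_reconstruct_def by blast
qed

text \<open>A competitor for the image edges also competes for \<open>F\<close>: only its edge
  assignment is composed with the image map, the graph \<open>H\<close> itself stays the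
  same.\<close>

lemma edge_cards_reconstruct_iso:
  assumes G: "simple_graph G" and iso: "is_iso \<phi> G G'"
    and F: "F \<subseteq> edges G" and rec: "edge_cards_reconstruct G F"
  shows "edge_cards_reconstruct G' ((\<lambda>e. \<phi> ` e) ` F)"
  unfolding edge_cards_reconstruct_def
proof (intro allI impI, elim conjE)
  let ?p = "\<lambda>e. \<phi> ` e"
  fix H :: "nat ugraph" and f
  assume H: "simple_graph H" "inj_on f (?p ` F)" "f ` ?p ` F \<subseteq> edges H"
    "\<forall>e\<in>?p ` F. del_edge H (f e) \<simeq> del_edge G' e"
  have inj: "inj_on ?p F"
    using inj_on_image_edges[OF G iso] F by (rule inj_on_subset)
  have "del_edge H ((f \<circ> ?p) e) \<simeq> del_edge G e" if "e \<in> F" for e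
  proof -
    have "is_iso \<phi> (del_edge G e) (del_edge G' (\<phi> ` e))"
      using is_iso_del_edge[OF G iso] F that by blast
    hence "del_edge G' (\<phi> ` e) \<simeq> del_edge G e"
      using graph_iso_sym[OF simple_graph_del_edge[OF G]] by (auto simp: graph_iso_iff)
    thus ?thesis using H(4) that by (auto intro: graph_iso_trans)
  qed
  moreover have "inj_on (f \<circ> ?p) F" using inj H(2) by (rule comp_inj_on)
  moreover have "(f \<circ> ?p) ` F \<subseteq> edges H" using H(3) by auto
  ultimately have "H \<simeq> G"
    using rec H(1) unfolding edge_cards_reconstruct_def by blast
  thus "H \<simeq> G'" using iso graph_iso_trans graph_iso_iff by blast
qed

lemma ex_reconstruct_iso:
  assumes "simple_graph G" "G \<simeq> G'"
    and "\<exists>F\<subseteq>edges G. card F = k \<and> edge_cards_reconstruct G F"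
  shows "\<exists>F\<subseteq>edges G'. card F = k \<and> edge_cards_reconstruct G' F"
proof -
  obtain \<phi> where iso: "is_iso \<phi> G G'" using assms(2) by (auto simp: graph_iso_iff)
  obtain F where F: "F \<subseteq> edges G" "card F = k" "edge_cards_reconstruct G F"
    using assms(3) by blast
  have "card ((\<lambda>e. \<phi> ` e) ` F) = k"
    using F inj_on_image_edges[OF assms(1) iso] by (metis card_image inj_on_subset)
  moreover have "(\<lambda>e. \<phi> ` e) ` F \<subseteq> edges G'" using F(1) iso by (auto simp: is_iso_def)
  ultimately show ?thesis
    using edge_cards_reconstruct_iso[OF assms(1) iso F(1,3)] by blast
qed

text \<open>Competitors are graphs on \<open>nat\<close> whatever the vertex type of
  \<open>G\<close> is, so the set of admissible \<open>k\<close> is the same on both sides. This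
  allows passing from the given caterpillar to a numbered copy of it.\<close>

lemma ern_iso:
  assumes "simple_graph G" "G \<simeq> G'"
  shows "ern G = ern G'"
proof -
  have "simple_graph G'"
    using assms is_iso_simple_graph by (auto simp: graph_iso_iff)
  hence "(\<exists>F\<subseteq>edges G. card F = k \<and> edge_cards_reconstruct G F) \<longleftrightarrow>
    (\<exists>F\<subseteq>edges G'. card F = k \<and> edge_cards_reconstruct G' F)" for k
    using ex_reconstruct_iso[of G G' k] ex_reconstruct_iso[of G' G k]
      assms graph_iso_sym by blast
  thus ?thesis by (simp add: ern_def)
qed

lemma is_iso_path:
  assumes "is_iso \<phi> G H" "is_path G p"
  shows "is_path H (map \<phi> p)"
proof -
  have p: "p \<noteq> []" "distinct p" "set p \<subseteq> verts G"
    "\<And>i. Suc i < length p \<Longrightarrow> {p ! i, p ! Suc i} \<in> edges G"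
    using assms(2) by (auto simp: is_path_def)
  have "distinct (map \<phi> p)"
    using p(2,3) assms(1)
    by (auto simp: distinct_map is_iso_def bij_betw_def intro: inj_on_subset)
  moreover have "set (map \<phi> p) \<subseteq> verts H"
    using p(3) assms(1) by (auto simp: is_iso_def bij_betw_def)
  moreover have "{map \<phi> p ! i, map \<phi> p ! Suc i} \<in> edges H" if "Suc i < length (map \<phi> p)" for i
  proof -
    have "\<phi> ` {p ! i, p ! Suc i} \<in> edges H"
      using p(4)[of i] that assms(1) by (auto simp: is_iso_def simp del: image_insert)
    thus ?thesis using that by simp
  qed
  ultimately show ?thesis using p(1) by (auto simp: is_path_def)
qed

lemma tree_diameter_iso:
  assumes "simple_graph G" "G \<simeq> H"
  shows "tree_diameter G = tree_diameter H"
proof -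
  obtain \<phi> where iso: "is_iso \<phi> G H" using assms(2) by (auto simp: graph_iso_iff)
  have "{length p - 1 |p. is_path G p} = {length p - 1 |p. is_path H p}"
    using is_iso_path[OF iso] is_iso_path[OF is_iso_inv[OF assms(1) iso]]
    by (smt (verit, best) Collect_cong length_map)
  thus ?thesis by (simp add: tree_diameter_def)
qed

section \<open>Isomorphism invariants: leaves, pairs of leaves, branching vertices\<close>

definition pendant :: "'v ugraph \<Rightarrow> 'v \<Rightarrow> 'v \<Rightarrow> bool" where
  "pendant G x u \<longleftrightarrow> {x, u} \<in> edges G \<and> (\<forall>w. {u, w} \<in> edges G \<longrightarrow> w = x)"

definition cherry :: "'v ugraph \<Rightarrow> 'v \<Rightarrow> bool" where
  "cherry G x \<longleftrightarrow> (\<exists>a b. a \<noteq> b \<and> pendant G x a \<and> pendant G x b)"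

text \<open>Degree at least three. Like \<open>pendant\<close> and \<open>cherry\<close>, it is
  phrased through neighbours instead of \<open>degree\<close>, so that membership of single edges
  decides it and no cardinality has to be computed.\<close>

definition branching :: "'v ugraph \<Rightarrow> 'v \<Rightarrow> bool" where
  "branching G x \<longleftrightarrow> (\<exists>a b c. a \<noteq> b \<and> a \<noteq> c \<and> b \<noteq> c \<and>
     {x, a} \<in> edges G \<and> {x, b} \<in> edges G \<and> {x, c} \<in> edges G)"

lemma is_iso_edge:
  assumes "is_iso \<phi> G H" "{a, b} \<in> edges G"
  shows "{\<phi> a, \<phi> b} \<in> edges H"
proof -
  have "\<phi> ` {a, b} \<in> edges H" using assms by (auto simp: is_iso_def simp del: image_insert)
  thus ?thesis by simp
qed

text \<open>Lifting edges back is what makes \<open>pendant\<close> invariant, as it restricts all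
  neighbours of a vertex and not only some.\<close>

lemma is_iso_edgeD:
  assumes "simple_graph G" "is_iso \<phi> G H" "u \<in> verts G" "{\<phi> u, w} \<in> edges H"
  obtains v where "w = \<phi> v" "{u, v} \<in> edges G"
proof -
  obtain e where e: "e \<in> edges G" "{\<phi> u, w} = \<phi> ` e"
    using assms(2,4) by (auto simp: is_iso_def)
  obtain a b where ab: "e = {a, b}" "a \<in> verts G" "b \<in> verts G"
    using simple_graph_edgeE[OF assms(1) e(1)] by metis
  have "inj_on \<phi> (verts G)" using assms(2) by (auto simp: is_iso_def bij_betw_def)
  with e ab assms(3) have "(u = a \<and> w = \<phi> b) \<or> (u = b \<and> w = \<phi> a)"
    by (auto simp: doubleton_eq_iff inj_on_def)
  thus ?thesis using that e ab by (auto simp: insert_commute)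
qed

lemma pendant_iso:
  assumes "simple_graph G" "is_iso \<phi> G H" "pendant G x u"
  shows "pendant H (\<phi> x) (\<phi> u)"
proof -
  have "u \<in> verts G"
    using simple_graph_edge(1)[OF assms(1)] assms(3) by (auto simp: pendant_def)
  thus ?thesis
    using assms is_iso_edge[OF assms(2)] is_iso_edgeD[OF assms(1,2)]
    unfolding pendant_def by metis
qed

lemma edge_in_verts:
  assumes "simple_graph G" "{a, b} \<in> edges G"
  shows "a \<in> verts G" "b \<in> verts G" "a \<noteq> b"
  using simple_graph_edge[OF assms] by (auto simp: card_2_iff)

lemma is_iso_inj:
  "is_iso \<phi> G H \<Longrightarrow> a \<in> verts G \<Longrightarrow> b \<in> verts G \<Longrightarrow> \<phi> a = \<phi> b \<longleftrightarrow> a = b"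
  unfolding is_iso_def bij_betw_def inj_on_def by blast

lemma cherry_iso:
  assumes "simple_graph G" "is_iso \<phi> G H" "cherry G x"
  shows "cherry H (\<phi> x)"
proof -
  obtain a b where ab: "a \<noteq> b" "pendant G x a" "pendant G x b"
    using assms(3) by (auto simp: cherry_def)
  have "\<phi> a \<noteq> \<phi> b"
    using ab edge_in_verts[OF assms(1)] is_iso_inj[OF assms(2)]
    unfolding pendant_def by metis
  thus ?thesis using ab pendant_iso[OF assms(1,2)] by (auto simp: cherry_def)
qed

lemma branching_iso:
  assumes "simple_graph G" "is_iso \<phi> G H" "branching G x"
  shows "branching H (\<phi> x)"
proof -
  obtain a b c where abc: "a \<noteq> b" "a \<noteq> c" "b \<noteq> c"
    "{x, a} \<in> edges G" "{x, b} \<in> edges G" "{x, c} \<in> edges G"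
    using assms(3) by (auto simp: branching_def)
  have "\<phi> a \<noteq> \<phi> b" "\<phi> a \<noteq> \<phi> c" "\<phi> b \<noteq> \<phi> c"
    using abc edge_in_verts[OF assms(1)] is_iso_inj[OF assms(2)] by metis+
  thus ?thesis using abc is_iso_edge[OF assms(2)] unfolding branching_def by blast
qed

lemma branching_in_verts: "simple_graph G \<Longrightarrow> branching G x \<Longrightarrow> x \<in> verts G"
  using edge_in_verts by (auto simp: branching_def)

section \<open>Graphs on an initial segment of the naturals, and the broom\<close>

definition gr :: "nat \<Rightarrow> (nat \<Rightarrow> nat \<Rightarrow> bool) \<Rightarrow> nat ugraph" where
  "gr N R = \<lparr>verts = {..N}, edges = {{a, b} | a b. R a b}\<rparr>"

text \<open>Each edge is represented by one pair, smaller end first, so deleting an edge amounts to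
  dropping one pair from the relation.\<close>

definition oriented :: "nat \<Rightarrow> (nat \<Rightarrow> nat \<Rightarrow> bool) \<Rightarrow> bool" where
  "oriented N R \<longleftrightarrow> (\<forall>a b. R a b \<longrightarrow> a < b \<and> b \<le> N)"

lemma verts_gr [simp]: "verts (gr N R) = {..N}"
  by (simp add: gr_def)

lemma edge_gr_iff [simp]: "{a, b} \<in> edges (gr N R) \<longleftrightarrow> R a b \<or> R b a"
  by (auto simp: gr_def doubleton_eq_iff)

lemma edge_grE:
  assumes "e \<in> edges (gr N R)"
  obtains a b where "e = {a, b}" "R a b"
  using assms by (auto simp: gr_def)

lemma simple_gr: "oriented N R \<Longrightarrow> simple_graph (gr N R)"
  by (force simp: simple_graph_def gr_def oriented_def)

lemma del_edge_gr:
  assumes "oriented N R" "x < y"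
  shows "del_edge (gr N R) {x, y} = gr N (\<lambda>a b. R a b \<and> \<not> (a = x \<and> b = y))"
  using assms by (fastforce simp: del_edge_def gr_def oriented_def doubleton_eq_iff)

text \<open>An involution is its own inverse, so \<open>s\<close> is a bijection at once. With
  equally many edges on both sides, it then suffices that \<open>s\<close> maps edges to edges: an
  injective image of full size is everything.\<close>

lemma gr_iso:
  assumes o: "oriented N R" "oriented N R'"
    and s: "\<And>a. a \<le> N \<Longrightarrow> s a \<le> N \<and> s (s a) = a"
    and R: "\<And>a b. R a b \<Longrightarrow> R' (s a) (s b) \<or> R' (s b) (s a)"
    and card: "card (edges (gr N R)) = card (edges (gr N R'))"
  shows "gr N R \<simeq> gr N R'"
proof -
  have b: "bij_betw s {..N} {..N}"
    by (rule bij_betw_byWitness[of _ s]) (use s in auto)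
  have pow: "edges (gr N R) \<subseteq> Pow {..N}" "edges (gr N R') \<subseteq> Pow {..N}"
    using o by (fastforce simp: gr_def oriented_def)+
  have "inj_on (\<lambda>e. s ` e) (Pow {..N})"
    using b by (auto simp: bij_betw_def intro: inj_on_image_Pow)
  hence "card ((\<lambda>e. s ` e) ` edges (gr N R)) = card (edges (gr N R'))"
    using pow(1) card by (metis card_image inj_on_subset)
  moreover have "(\<lambda>e. s ` e) ` edges (gr N R) \<subseteq> edges (gr N R')"
    using R by (auto elim!: edge_grE)
  moreover have "finite (edges (gr N R'))"
    using pow(2) by (rule finite_subset) auto
  ultimately have "edges (gr N R') = (\<lambda>e. s ` e) ` edges (gr N R)"
    by (metis card_subset_eq)
  thus ?thesis using b unfolding graph_iso_def by auto
qed

text \<open>The caterpillar \<open>C(2,0,\<dots>,0,2)\<close> on the vertices \<open>0, \<dots>, N\<close>: its spine is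
  \<open>2, \<dots>, N - 2\<close>, and the pairs of leaves at its ends are \<open>0, 1\<close> and \<open>N - 1, N\<close>.\<close>

definition broom :: "nat \<Rightarrow> nat \<Rightarrow> nat \<Rightarrow> bool" where
  "broom N a b \<longleftrightarrow> (1 \<le> a \<and> a + 2 \<le> N \<and> b = a + 1) \<or> (a = 0 \<and> b = 2) \<or> (b = a + 2 \<and> b = N)"

lemma oriented_broom: "3 \<le> N \<Longrightarrow> oriented N (broom N)"
  by (auto simp: oriented_def broom_def)

text \<open>The edge \<open>p\<close> traded for \<open>q\<close>. Competitors are written in this
  form because, for a non-edge \<open>q\<close>, deleting \<open>q\<close> again returns the card of
  \<open>p\<close>.\<close>

definition exchange :: "(nat \<Rightarrow> nat \<Rightarrow> bool) \<Rightarrow> nat \<times> nat \<Rightarrow> nat \<times> nat \<Rightarrow> nat \<Rightarrow> nat \<Rightarrow> bool" where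
  "exchange R p q a b \<longleftrightarrow> (R a b \<and> (a, b) \<noteq> p) \<or> (a, b) = q"

definition remove :: "(nat \<Rightarrow> nat \<Rightarrow> bool) \<Rightarrow> nat \<times> nat \<Rightarrow> nat \<Rightarrow> nat \<Rightarrow> bool" where
  "remove R p a b \<longleftrightarrow> R a b \<and> (a, b) \<noteq> p"

lemma del_edge_remove:
  "oriented N R \<Longrightarrow> x < y \<Longrightarrow> del_edge (gr N R) {x, y} = gr N (remove R (x, y))"
  by (simp add: del_edge_gr remove_def[abs_def])

lemma remove_exchange:
  "\<not> R (fst q) (snd q) \<Longrightarrow> remove (exchange R p q) q = remove R p"
  by (auto simp: fun_eq_iff remove_def exchange_def)

lemma broom_step: "1 \<le> a \<Longrightarrow> a + 2 \<le> N \<Longrightarrow> b = a + 1 \<Longrightarrow> broom N a b"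
  and broom_left: "broom N 0 2"
  and broom_right: "b = a + 2 \<Longrightarrow> b = N \<Longrightarrow> broom N a b"
  by (simp_all add: broom_def)

lemma broom_cases:
  assumes "broom N a b"
  obtains "1 \<le> a" "a + 2 \<le> N" "b = a + 1" | "a = 0" "b = 2" | "a + 2 = N" "b = N"
  using assms unfolding broom_def by metis

lemma oriented_remove: "oriented N R \<Longrightarrow> oriented N (remove R p)"
  by (auto simp: oriented_def remove_def)

lemma oriented_exchange:
  "oriented N R \<Longrightarrow> q1 < q2 \<Longrightarrow> q2 \<le> N \<Longrightarrow> oriented N (exchange R p (q1, q2))"
  by (auto simp: oriented_def exchange_def)

lemma finite_edges: "simple_graph G \<Longrightarrow> finite (edges G)"
  by (rule finite_subset[of _ "Pow (verts G)"]) (auto simp: simple_graph_def)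

lemma card_edges_remove:
  assumes "oriented N R" "R x y"
  shows "card (edges (gr N R)) = Suc (card (edges (gr N (remove R (x, y)))))"
proof -
  have "x < y" using assms by (auto simp: oriented_def)
  hence "edges (gr N (remove R (x, y))) = edges (gr N R) - {{x, y}}"
    using del_edge_remove[OF assms(1)] by (metis del_edge_def ugraph.select_convs(2))
  moreover have "{x, y} \<in> edges (gr N R)" using assms(2) by simp
  ultimately show ?thesis
    using finite_edges[OF simple_gr[OF assms(1)]] by (metis card.remove)
qed

lemma card_edges_exchange:
  assumes "oriented N R" "R p1 p2" "\<not> R q1 q2" "q1 < q2" "q2 \<le> N"
  shows "card (edges (gr N (exchange R (p1, p2) (q1, q2)))) = card (edges (gr N R))"
proof -
  have "exchange R (p1, p2) (q1, q2) q1 q2" by (simp add: exchange_def)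
  thus ?thesis
    using card_edges_remove[OF oriented_exchange[OF assms(1,4,5)]]
      card_edges_remove[OF assms(1,2)] remove_exchange[of R "(q1, q2)"] assms(3) by simp
qed

abbreviation card_at :: "nat \<Rightarrow> nat \<Rightarrow> nat \<Rightarrow> nat ugraph" where
  "card_at N x y \<equiv> gr N (remove (broom N) (x, y))"

lemma card_at_iso:
  assumes N: "3 \<le> N" and xy: "broom N x y" "broom N x' y'"
    and s: "\<And>a. a \<le> N \<Longrightarrow> s a \<le> N \<and> s (s a) = a"
    and R: "\<And>a b. broom N a b \<Longrightarrow> (a, b) \<noteq> (x, y) \<Longrightarrow>
      remove (broom N) (x', y') (s a) (s b) \<or> remove (broom N) (x', y') (s b) (s a)"
  shows "card_at N x y \<simeq> card_at N x' y'"
proof (rule gr_iso[where s = s])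
  note o = oriented_broom[OF N]
  show "card (edges (card_at N x y)) = card (edges (card_at N x' y'))"
    using card_edges_remove[OF o xy(1)] card_edges_remove[OF o xy(2)] by simp
  show "oriented N (remove (broom N) (x, y))" "oriented N (remove (broom N) (x', y'))"
    using o by (auto intro: oriented_remove)
qed (use s R in \<open>auto simp: remove_def\<close>)

text \<open>This is a relation between cards rather than edges, so each card may be replaced by an
  isomorphic one; in particular \<open>ambiguous N K K\<close> is meaningful.\<close>

definition ambiguous :: "nat \<Rightarrow> nat ugraph \<Rightarrow> nat ugraph \<Rightarrow> bool" where
  "ambiguous N K1 K2 \<longleftrightarrow> (\<exists>H f1 f2. simple_graph (H :: nat ugraph) \<and> f1 \<in> edges H \<and> f2 \<in> edges H \<and>
     f1 \<noteq> f2 \<and> del_edge H f1 \<simeq> K1 \<and> del_edge H f2 \<simeq> K2 \<and> \<not> H \<simeq> gr N (broom N))"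

lemma ambiguous_sym: "ambiguous N K1 K2 \<Longrightarrow> ambiguous N K2 K1"
  unfolding ambiguous_def by metis

lemma ambiguous_iso:
  "ambiguous N K1 K2 \<Longrightarrow> K1 \<simeq> K1' \<Longrightarrow> K2 \<simeq> K2' \<Longrightarrow> ambiguous N K1' K2'"
  unfolding ambiguous_def using graph_iso_trans by blast

lemma not_reconstruct_ambiguous:
  assumes "e1 \<noteq> e2" "ambiguous N (del_edge (gr N (broom N)) e1) (del_edge (gr N (broom N)) e2)"
  shows "\<not> edge_cards_reconstruct (gr N (broom N)) {e1, e2}"
proof -
  let ?B = "gr N (broom N)"
  obtain H :: "nat ugraph" and f1 f2 where H: "simple_graph H" "f1 \<in> edges H" "f2 \<in> edges H"
    "f1 \<noteq> f2" "del_edge H f1 \<simeq> del_edge ?B e1" "del_edge H f2 \<simeq> del_edge ?B e2" "\<not> H \<simeq> ?B"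
    using assms(2) unfolding ambiguous_def by blast
  have "inj_on (\<lambda>e. if e = e1 then f1 else f2) {e1, e2}"
    "(\<lambda>e. if e = e1 then f1 else f2) ` {e1, e2} \<subseteq> edges H"
    "\<forall>e\<in>{e1, e2}. del_edge H ((\<lambda>e. if e = e1 then f1 else f2) e) \<simeq> del_edge ?B e"
    using H assms(1) by auto
  with H(1,7) show ?thesis unfolding edge_cards_reconstruct_def by blast
qed

text \<open>The common scheme for all competitors: in broom minus \<open>p\<close> plus
  \<open>q\<close>, deleting \<open>q\<close> gives the card of \<open>p\<close>, and deleting
  \<open>r\<close> gives the card of \<open>t\<close> up to the relabelling \<open>s\<close>. The
  edges \<open>r\<close> and \<open>t\<close> may differ, and \<open>t\<close> may equal
  \<open>p\<close>.\<close>

lemma ambiguous_exchange: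
  assumes N: "3 \<le> N" and p: "broom N px py" and q: "\<not> broom N qx qy" "qx < qy" "qy \<le> N"
    and r: "broom N rx ry" "(px, py) \<noteq> (rx, ry)" and t: "broom N tx ty"
    and s: "\<And>a. a \<le> N \<Longrightarrow> s a \<le> N \<and> s (s a) = a"
    and R: "\<And>a b. broom N a b \<Longrightarrow> (a, b) \<noteq> (tx, ty) \<Longrightarrow>
      remove (exchange (broom N) (px, py) (qx, qy)) (rx, ry) (s a) (s b) \<or>
      remove (exchange (broom N) (px, py) (qx, qy)) (rx, ry) (s b) (s a)"
    and not_iso: "\<not> gr N (exchange (broom N) (px, py) (qx, qy)) \<simeq> gr N (broom N)"
  shows "ambiguous N (card_at N px py) (card_at N tx ty)"
proof -
  define R where "R = exchange (broom N) (px, py) (qx, qy)"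
  note o = oriented_broom[OF N]
  have oR: "oriented N R" unfolding R_def by (rule oriented_exchange[OF o q(2,3)])
  have rxy: "rx < ry" using o r(1) by (auto simp: oriented_def)
  have Rr: "R rx ry" using r by (auto simp: R_def exchange_def)
  have "card_at N tx ty \<simeq> gr N (remove R (rx, ry))"
  proof (rule gr_iso[where s = s])
    show "oriented N (remove (broom N) (tx, ty))" "oriented N (remove R (rx, ry))"
      using o oR by (auto intro: oriented_remove)
    show "card (edges (card_at N tx ty)) = card (edges (gr N (remove R (rx, ry))))"
      using card_edges_remove[OF o t] card_edges_remove[OF oR Rr]
        card_edges_exchange[OF o p q] by (simp add: R_def)
    fix a b assume "remove (broom N) (tx, ty) a b"
    thus "remove R (rx, ry) (s a) (s b) \<or> remove R (rx, ry) (s b) (s a)"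
      using R unfolding R_def by (auto simp: remove_def)
  qed (rule s)
  moreover have "simple_graph (card_at N tx ty)"
    by (rule simple_gr[OF oriented_remove[OF o]])
  ultimately have "gr N (remove R (rx, ry)) \<simeq> card_at N tx ty"
    by (rule graph_iso_sym[rotated])
  hence "del_edge (gr N R) {rx, ry} \<simeq> card_at N tx ty"
    using del_edge_remove[OF oR rxy] by simp
  moreover have "{qx, qy} \<in> edges (gr N R)" "{rx, ry} \<in> edges (gr N R)"
    using Rr by (auto simp: R_def exchange_def)
  moreover have "{qx, qy} \<noteq> {rx, ry}"
    using q rxy r(1) by (auto simp: doubleton_eq_iff)
  moreover have "del_edge (gr N R) {qx, qy} \<simeq> card_at N px py"
    using del_edge_remove[OF oR q(2)] remove_exchange[of "broom N" "(qx, qy)"] q(1)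
    by (simp add: R_def graph_iso_refl)
  ultimately show ?thesis
    unfolding ambiguous_def using simple_gr[OF oR] not_iso R_def by blast
qed

section \<open>Invariants separating competitors from the broom\<close>

lemma broom_cherry:
  assumes "6 \<le> N"
  shows "cherry (gr N (broom N)) 2" "cherry (gr N (broom N)) (N - 2)"
proof -
  have "pendant (gr N (broom N)) 2 0" "pendant (gr N (broom N)) 2 1"
    "pendant (gr N (broom N)) (N - 2) (N - 1)" "pendant (gr N (broom N)) (N - 2) N"
    using assms by (auto simp: pendant_def broom_def)
  moreover have "(0::nat) \<noteq> 1" "N - 1 \<noteq> N" using assms by auto
  ultimately show "cherry (gr N (broom N)) 2" "cherry (gr N (broom N)) (N - 2)"
    unfolding cherry_def by blast+
qed

lemma broom_branching:
  assumes "6 \<le> N" "branching (gr N (broom N)) x"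
  shows "x = 2 \<or> x = N - 2"
proof (rule ccontr)
  assume "\<not> ?thesis"
  \<comment> \<open>Every other vertex has its neighbours inside a set of two, too few for three
    distinct ones. The leaves \<open>0\<close> and \<open>N\<close> are treated apart, since they
    differ by 2 from their neighbours in the numbering.\<close>
  hence "w = x + 1 \<or> w = x - 1" if "{x, w} \<in> edges (gr N (broom N))" 
      "x \<noteq> 0" "x \<noteq> N" for w
    using that assms(1) by (auto simp: broom_def)
  moreover have "w = 2 \<or> w = N - 2" if "{x, w} \<in> edges (gr N (broom N))" "x = 0 \<or> x = N" for w
    using that assms(1) by (auto simp: broom_def)
  ultimately show False using assms(2) unfolding branching_def by metis
qed

text \<open>The broom has pairs of leaves at the two distinct vertices \<open>2\<close> and
  \<open>N - 2\<close>, and an isomorphism would have to send both to \<open>y\<close>.\<close>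

lemma not_iso_broom_cherry:
  assumes "6 \<le> N" "oriented N R" "\<And>x. cherry (gr N R) x \<Longrightarrow> x = y"
  shows "\<not> gr N R \<simeq> gr N (broom N)"
proof
  assume "gr N R \<simeq> gr N (broom N)"
  hence "gr N (broom N) \<simeq> gr N R" using simple_gr[OF assms(2)] by (rule graph_iso_sym[rotated])
  then obtain \<phi> where iso: "is_iso \<phi> (gr N (broom N)) (gr N R)"
    by (auto simp: graph_iso_iff)
  have s: "simple_graph (gr N (broom N))" using assms(1) by (intro simple_gr oriented_broom) auto
  have "\<phi> 2 = \<phi> (N - 2)"
    using cherry_iso[OF s iso] broom_cherry[OF assms(1)] assms(3) by metis
  moreover have "\<phi> 2 \<noteq> \<phi> (N - 2)"
    using is_iso_inj[OF iso, of 2 "N - 2"] assms(1) by auto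
  ultimately show False by blast
qed

text \<open>Pigeonhole: three branching vertices cannot be mapped injectively to the two of the
  broom.\<close>

lemma not_iso_broom_branching:
  assumes "6 \<le> N" "oriented N R" "x \<noteq> y" "x \<noteq> z" "y \<noteq> z"
    "branching (gr N R) x" "branching (gr N R) y" "branching (gr N R) z"
  shows "\<not> gr N R \<simeq> gr N (broom N)"
proof
  assume "gr N R \<simeq> gr N (broom N)"
  then obtain \<phi> where iso: "is_iso \<phi> (gr N R) (gr N (broom N))" by (auto simp: graph_iso_iff)
  note s = simple_gr[OF assms(2)]
  note d = is_iso_inj[OF iso branching_in_verts[OF s] branching_in_verts[OF s]]
  have "\<phi> w = 2 \<or> \<phi> w = N - 2" if "branching (gr N R) w" for w
    using branching_iso[OF s iso that] by (rule broom_branching[OF assms(1)])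
  hence "\<phi> x = \<phi> y \<or> \<phi> x = \<phi> z \<or> \<phi> y = \<phi> z" using assms(6-8) by metis
  thus False using d assms(3-8) by metis
qed

section \<open>Cards up to the symmetries of the broom\<close>

lemma card_at_reflect:
  assumes "6 \<le> N" "broom N x y"
  shows "card_at N x y \<simeq> card_at N (N - y) (N - x)"
proof (rule card_at_iso[where s = "\<lambda>a. N - a"])
  have refl: "broom N (N - b) (N - a)" if "broom N a b" for a b
    using that
  proof (cases rule: broom_cases)
    case 1
    thus ?thesis by (intro broom_step) auto
  next
    case 2
    thus ?thesis using assms(1) by (intro broom_right) auto
  next
    case 3
    hence "N - b = 0" "N - a = 2" by auto
    thus ?thesis by (simp add: broom_left)
  qed
  show "broom N (N - y) (N - x)" by (rule refl[OF assms(2)])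
  fix a b assume ab: "broom N a b" "(a, b) \<noteq> (x, y)"
  have "a \<le> N" "b \<le> N" "x \<le> N" "y \<le> N"
    using ab(1) assms(2) oriented_broom[of N] assms(1) by (force simp: oriented_def)+
  hence "(N - b, N - a) \<noteq> (N - y, N - x)" using ab(2) by auto
  thus "remove (broom N) (N - y, N - x) (N - a) (N - b) \<or>
      remove (broom N) (N - y, N - x) (N - b) (N - a)"
    using refl[OF ab(1)] by (simp add: remove_def)
qed (use assms in auto)

text \<open>The two leaves at \<open>N - 2\<close> are interchangeable; \<open>s\<close> transposes
  them.\<close>

lemma card_at_swap_right:
  assumes "6 \<le> N"
  shows "card_at N (N - 2) (N - 1) \<simeq> card_at N (N - 2) N"
proof -
  define s where "s = (\<lambda>a. if a = N then N - 1 else if a = N - 1 then N else a)"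
  show ?thesis
  proof (rule card_at_iso[where s = s])
    show "broom N (N - 2) (N - 1)" using assms by (intro broom_step) auto
    show "broom N (N - 2) N" using assms by (intro broom_right) auto
    fix a assume "a \<le> N"
    thus "s a \<le> N \<and> s (s a) = a" using assms by (auto simp: s_def)
  next
    fix a b assume ab: "broom N a b" "(a, b) \<noteq> (N - 2, N - 1)"
    from ab(1) have "remove (broom N) (N - 2, N) (s a) (s b)"
    proof (cases rule: broom_cases)
      case 1
      hence "s a = a" "s b = b" using ab(2) by (auto simp: s_def)
      thus ?thesis using 1 by (auto simp: remove_def intro: broom_step)
    next
      case 2
      hence "s a = a" "s b = b" using assms by (auto simp: s_def)
      thus ?thesis using 2 assms by (auto simp: remove_def broom_left)
    next
      case 3
      hence "s a = a" "s b = N - 1" using assms by (auto simp: s_def)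
      thus ?thesis using 3 assms by (auto simp: remove_def intro: broom_step)
    qed
    thus "remove (broom N) (N - 2, N) (s a) (s b) \<or> remove (broom N) (N - 2, N) (s b) (s a)" ..
  qed (use assms in auto)
qed

lemma card_at_cases:
  assumes "6 \<le> N" "N = 2 * m" "broom N x y"
  shows "card_at N x y \<simeq> card_at N (N - 2) N \<or>
    (\<exists>k. 2 \<le> k \<and> k + 1 \<le> m \<and> card_at N x y \<simeq> card_at N k (k + 1))"
proof -
  have *: "card_at N x' y' \<simeq> card_at N (N - 2) N"
    if "x' = N - 2" "y' = N - 1 \<or> y' = N" for x' y'
    using that card_at_swap_right[OF assms(1)] graph_iso_refl by auto
  \<comment> \<open>In turn: the two left leaves, the left half of the spine, the right half of the
    spine, the right leaves. Reflection carries the left leaves to the right and the right half of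
    the spine to the left.\<close>
  consider "x = 0" "y = 2" | "x = 1" "y = 2" | "2 \<le> x" "x + 1 \<le> m" "y = x + 1"
    | "m \<le> x" "x + 3 \<le> N" "y = x + 1" | "x = N - 2" "y = N - 1 \<or> y = N"
    using assms by (auto simp: broom_def) linarith+
  thus ?thesis
  proof cases
    case 1
    have "card_at N x y \<simeq> card_at N (N - 2) N"
      using card_at_reflect[OF assms(1,3)] 1 by simp
    thus ?thesis ..
  next
    case 2
    have "card_at N x y \<simeq> card_at N (N - 2) (N - 1)"
      using card_at_reflect[OF assms(1,3)] 2 by simp
    thus ?thesis using card_at_swap_right[OF assms(1)] graph_iso_trans by blast
  next
    case 3
    thus ?thesis using graph_iso_refl by blast
  next
    case 4
    have "N - x = (N - y) + 1" using 4 assms(1) by auto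
    hence "card_at N x y \<simeq> card_at N (N - y) ((N - y) + 1)"
      using card_at_reflect[OF assms(1,3)] by simp
    moreover have "2 \<le> N - y" "N - y + 1 \<le> m" using 4 assms(2) by auto
    ultimately show ?thesis by blast
  next
    case 5
    thus ?thesis using * by blast
  qed
qed

section \<open>Competitors for pairs of cards\<close>

lemma not_iso_pendant_moved:
  assumes "6 \<le> N" "2 \<le> j" "j + 3 \<le> N" "j \<noteq> 3"
  shows "\<not> gr N (exchange (broom N) (N - 2, N) (j, N)) \<simeq> gr N (broom N)"
proof (rule not_iso_broom_cherry[OF assms(1), of _ 2])
  let ?G = "gr N (exchange (broom N) (N - 2, N) (j, N))"
  show "oriented N (exchange (broom N) (N - 2, N) (j, N))"
    using assms by (intro oriented_exchange oriented_broom) auto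
  fix x assume "cherry ?G x"
  then obtain a b where ab: "a \<noteq> b" "pendant ?G x a" "pendant ?G x b"
    by (auto simp: cherry_def)
  have leaf: "(u = 0 \<and> x = 2) \<or> (u = 1 \<and> x = 2) \<or> (u = N \<and> x = j) \<or> (u = N - 1 \<and> x = N - 2)"
    if "pendant ?G x u" for u
  proof -
    have e: "{x, u} \<in> edges ?G" and l: "\<And>w. {u, w} \<in> edges ?G \<Longrightarrow> w = x"
      using that by (auto simp: pendant_def)
    \<comment> \<open>A vertex of the old spine keeps both its path neighbours, so it is no leaf.
      The only leaves left are \<open>0\<close>, \<open>1\<close>, \<open>N - 1\<close> and
      \<open>N\<close>, and \<open>N - 2\<close> retains just one of them.\<close>
    have nu: "\<not> (2 \<le> u \<and> u + 2 \<le> N)"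
    proof
      assume u: "2 \<le> u \<and> u + 2 \<le> N"
      have "broom N u (u + 1)" "broom N (u - 1) u" using u by (auto intro: broom_step)
      hence "{u, u + 1} \<in> edges ?G" "{u, u - 1} \<in> edges ?G" using u by (auto simp: exchange_def)
      hence "u + 1 = u - 1" using l by metis
      thus False by auto
    qed
    consider "broom N x u" "(x, u) \<noteq> (N - 2, N)" | "broom N u x" | "(x, u) = (j, N)" | "(u, x) = (j, N)"
      using e by (auto simp: exchange_def)
    thus ?thesis
    proof cases
      case 1
      from 1(1) show ?thesis by (cases rule: broom_cases) (use nu 1(2) assms(1) in auto)
    next
      case 2
      thus ?thesis by (cases rule: broom_cases) (use nu assms(1) in auto)
    qed (use nu assms in auto)
  qed
  show "x = 2" using leaf[OF ab(2)] leaf[OF ab(3)] ab(1) assms by auto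
qed

lemma remove_exchange_old:
  "R a b \<Longrightarrow> (a, b) \<noteq> p \<Longrightarrow> (a, b) \<noteq> r \<Longrightarrow> remove (exchange R p q) r a b"
  by (simp add: remove_def exchange_def)

lemma remove_exchange_new: "(a, b) = q \<Longrightarrow> q \<noteq> r \<Longrightarrow> remove (exchange R p q) r a b"
  by (simp add: remove_def exchange_def)

text \<open>Moving \<open>N\<close> to \<open>2\<close> puts three leaves at \<open>2\<close>.
  Detaching \<open>N\<close> or \<open>0\<close> gives the same card up to swapping these
  two.\<close>

lemma ambiguous_leaf_leaf:
  assumes "6 \<le> N"
  shows "ambiguous N (card_at N (N - 2) N) (card_at N (N - 2) N)"
proof -
  define s where "s = (\<lambda>a. if a = N then 0 else if a = 0 then N else a)"
  let ?R = "remove (exchange (broom N) (N - 2, N) (2, N)) (0, 2)"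
  show ?thesis
  proof (rule ambiguous_exchange[where qx = 2 and qy = N and rx = 0 and ry = 2 and s = s])
    show "\<not> gr N (exchange (broom N) (N - 2, N) (2, N)) \<simeq> gr N (broom N)"
      using assms by (intro not_iso_pendant_moved) auto
    fix a b assume ab: "broom N a b" "(a, b) \<noteq> (N - 2, N)"
    from ab(1) show "?R (s a) (s b) \<or> ?R (s b) (s a)"
    proof (cases rule: broom_cases)
      case 1
      hence "s a = a" "s b = b" by (auto simp: s_def)
      thus ?thesis using 1 assms
        by (intro disjI1 remove_exchange_old) (auto intro: broom_step)
    next
      case 2
      hence "s a = N" "s b = 2" using assms by (auto simp: s_def)
      thus ?thesis using assms by (intro disjI2 remove_exchange_new) auto
    next
      case 3
      thus ?thesis using ab(2) by auto
    qed
  qed (use assms in \<open>auto simp: broom_def s_def\<close>)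
qed

text \<open>The leaf \<open>N\<close> moves to \<open>k + 2\<close>. Once \<open>(k, k + 1)\<close>
  is deleted, the right part is the path from \<open>k + 1\<close> to \<open>N - 1\<close> with
  \<open>N\<close> hung next to its first vertex instead of its last, so reversing this path gives
  the right part of the broom.\<close>

lemma ambiguous_leaf_inner:
  assumes "6 \<le> N" "2 \<le> k" "k + 5 \<le> N"
  shows "ambiguous N (card_at N (N - 2) N) (card_at N k (k + 1))"
proof -
  define s where "s = (\<lambda>a. if k + 1 \<le> a \<and> a < N then N + k - a else a)"
  let ?R = "remove (exchange (broom N) (N - 2, N) (k + 2, N)) (k, k + 1)"
  show ?thesis
  proof (rule ambiguous_exchange[where qx = "k + 2" and qy = N and rx = k and ry = "k + 1" and s = s])
    show "\<not> gr N (exchange (broom N) (N - 2, N) (k + 2, N)) \<simeq> gr N (broom N)"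
      using assms by (intro not_iso_pendant_moved) auto
    fix a b assume ab: "broom N a b" "(a, b) \<noteq> (k, k + 1)"
    from ab(1) show "?R (s a) (s b) \<or> ?R (s b) (s a)"
    proof (cases rule: broom_cases)
      case 1
      then consider "a < k" | "k + 1 \<le> a" using ab(2) by fastforce
      thus ?thesis
      proof cases
        case 1
        hence "s a = a" "s b = b" using \<open>b = a + 1\<close> by (auto simp: s_def)
        thus ?thesis using 1 \<open>1 \<le> a\<close> \<open>a + 2 \<le> N\<close> \<open>b = a + 1\<close>
          by (intro disjI1 remove_exchange_old) (auto intro: broom_step)
      next
        case 2
        hence "s a = s b + 1" "k + 1 \<le> s b" "s b + 2 \<le> N"
          using \<open>a + 2 \<le> N\<close> \<open>b = a + 1\<close> by (auto simp: s_def)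
        thus ?thesis by (intro disjI2 remove_exchange_old) (auto intro: broom_step)
      qed
    next
      case 2
      hence "s a = a" "s b = b" using assms by (auto simp: s_def)
      thus ?thesis using 2 assms
        by (intro disjI1 remove_exchange_old) (auto intro: broom_left)
    next
      case 3
      hence "s a = k + 2" "s b = N" using assms by (auto simp: s_def)
      thus ?thesis using assms by (intro disjI1 remove_exchange_new) auto
    qed
  qed (use assms in \<open>auto simp: broom_def s_def\<close>)
qed

lemma branchingI:
  "a \<noteq> b \<Longrightarrow> a \<noteq> c \<Longrightarrow> b \<noteq> c \<Longrightarrow> {x, a} \<in> edges G \<Longrightarrow> {x, b} \<in> edges G \<Longrightarrow>
    {x, c} \<in> edges G \<Longrightarrow> branching G x"
  unfolding branching_def by blast

text \<open>The edge leaving \<open>k\<close> is redirected to \<open>l\<close>. After deletion of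
  \<open>(l, l + 1)\<close> the segment from \<open>k + 1\<close> to \<open>l\<close> is merely
  entered from its other end, and \<open>s\<close> reverses it. The third branching vertex is
  \<open>l\<close>: as \<open>k + 2 \<le> l\<close>, its neighbours \<open>l - 1\<close> and
  \<open>k\<close> differ.\<close>

lemma ambiguous_inner_inner:
  assumes "6 \<le> N" "2 \<le> k" "k + 2 \<le> l" "l + 3 \<le> N"
  shows "ambiguous N (card_at N k (k + 1)) (card_at N l (l + 1))"
proof -
  define s where "s = (\<lambda>a. if k + 1 \<le> a \<and> a \<le> l then k + 1 + l - a else a)"
  let ?H = "exchange (broom N) (k, k + 1) (k, l)"
  let ?R = "remove ?H (l, l + 1)"
  show ?thesis
  proof (rule ambiguous_exchange[where qx = k and qy = l and rx = l and ry = "l + 1" and s = s])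
    fix a b assume ab: "broom N a b" "(a, b) \<noteq> (l, l + 1)"
    from ab(1) show "?R (s a) (s b) \<or> ?R (s b) (s a)"
    proof (cases rule: broom_cases)
      case 1
      then consider "a < k \<or> l < a" | "a = k" | "k + 1 \<le> a" "a < l" using ab(2) by fastforce
      thus ?thesis
      proof cases
        case 1
        hence "s a = a" "s b = b" using \<open>b = a + 1\<close> assms by (auto simp: s_def)
        thus ?thesis using 1 \<open>1 \<le> a\<close> \<open>a + 2 \<le> N\<close> \<open>b = a + 1\<close> assms
          by (intro disjI1 remove_exchange_old) (auto intro: broom_step)
      next
        case 2
        hence "s a = k" "s b = l" using \<open>b = a + 1\<close> assms by (auto simp: s_def)
        thus ?thesis using assms by (intro disjI1 remove_exchange_new) auto
      next
        case 3
        hence "s a = s b + 1" "k + 1 \<le> s b" "s b < l"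
          using \<open>b = a + 1\<close> by (auto simp: s_def)
        thus ?thesis using assms by (intro disjI2 remove_exchange_old) (auto intro: broom_step)
      qed
    next
      case 2
      hence "s a = a" "s b = b" using assms by (auto simp: s_def)
      thus ?thesis using 2 assms
        by (intro disjI1 remove_exchange_old) (auto intro: broom_left)
    next
      case 3
      hence "s a = a" "s b = b" using assms by (auto simp: s_def)
      thus ?thesis using 3 assms
        by (intro disjI1 remove_exchange_old) (auto intro: broom_right)
    qed
  next
    have "branching (gr N ?H) 2"
      by (rule branchingI[of 0 1 "if k = 2 then l else 3"])
        (use assms in \<open>auto simp: exchange_def broom_left broom_step\<close>)
    moreover have "branching (gr N ?H) l"
      by (rule branchingI[of "l - 1" "l + 1" k])
        (use assms in \<open>auto simp: exchange_def broom_step\<close>)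
    moreover have "branching (gr N ?H) (N - 2)"
      by (rule branchingI[of "N - 1" N "N - 3"])
        (use assms in \<open>auto simp: exchange_def broom_step broom_right\<close>)
    moreover have "oriented N ?H"
      using assms by (intro oriented_exchange oriented_broom) auto
    moreover have "2 \<noteq> l" "2 \<noteq> N - 2" "l \<noteq> N - 2" using assms by auto
    ultimately show "\<not> gr N ?H \<simeq> gr N (broom N)"
      using not_iso_broom_branching[OF assms(1)] by blast
  qed (use assms in \<open>auto simp: broom_def s_def\<close>)
qed

text \<open>The edge \<open>(m - 1, m)\<close> and its mirror image \<open>(m, m + 1)\<close> are
  too close for \<open>ambiguous_inner_inner\<close>. The competitor here is disconnected: the part
  right of the deleted edge acquires a cycle through \<open>m + 1, ..., N - 1\<close>, which can be
  opened at \<open>q\<close> or at \<open>(N - 2, N - 1)\<close> with isomorphic results. For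
  \<open>4 \<le> m\<close> the vertices \<open>2\<close>, \<open>m + 1\<close> and
  \<open>N - 2\<close> are distinct and all branch.\<close>

lemma ambiguous_middle_middle:
  assumes "4 \<le> m" "N = 2 * m"
  shows "ambiguous N (card_at N (m - 1) m) (card_at N (m - 1) m)"
proof -
  \<comment> \<open>With the cycle opened at \<open>(N - 2, N - 1)\<close>, the vertex
    \<open>m + 1\<close> carries the leaves \<open>m\<close> and \<open>N - 1\<close>, and
    \<open>N - 2\<close> carries \<open>N\<close>. So \<open>s\<close> reverses
    \<open>m + 1, ..., N - 2\<close>, swaps \<open>m\<close> with \<open>N\<close>, and fixes
    \<open>N - 1\<close>.\<close>
  define s where "s = (\<lambda>a. if m + 1 \<le> a \<and> a + 2 \<le> N then m + N - 1 - a
    else if a = m then N else if a = N then m else a)"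
  let ?H = "exchange (broom N) (m - 1, m) (m + 1, N - 1)"
  let ?R = "remove ?H (N - 2, N - 1)"
  show ?thesis
  proof (rule ambiguous_exchange[where qx = "m + 1" and qy = "N - 1" and rx = "N - 2" and ry = "N - 1"
        and s = s])
    fix a b assume ab: "broom N a b" "(a, b) \<noteq> (m - 1, m)"
    from ab(1) show "?R (s a) (s b) \<or> ?R (s b) (s a)"
    proof (cases rule: broom_cases)
      case 1
      then consider "a + 1 < m" | "a = m" | "m + 1 \<le> a" "a + 2 < N" | "a + 2 = N"
        using ab(2) assms by fastforce
      thus ?thesis
      proof cases
        case 1
        hence "s a = a" "s b = b" using \<open>b = a + 1\<close> assms by (auto simp: s_def)
        thus ?thesis using 1 \<open>1 \<le> a\<close> \<open>a + 2 \<le> N\<close> \<open>b = a + 1\<close> assms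
          by (intro disjI1 remove_exchange_old) (auto intro: broom_step)
      next
        case 2
        hence "s a = N" "s b = N - 2" using \<open>b = a + 1\<close> assms by (auto simp: s_def)
        thus ?thesis using assms
          by (intro disjI2 remove_exchange_old) (auto intro: broom_right)
      next
        case 3
        hence "s a = s b + 1" "m + 1 \<le> s b" "s b + 2 < N"
          using \<open>b = a + 1\<close> by (auto simp: s_def)
        thus ?thesis using assms by (intro disjI2 remove_exchange_old) (auto intro: broom_step)
      next
        case 4
        hence "s a = m + 1" "s b = N - 1" using \<open>b = a + 1\<close> assms by (auto simp: s_def)
        thus ?thesis using assms by (intro disjI1 remove_exchange_new) auto
      qed
    next
      case 2
      hence "s a = a" "s b = b" using assms by (auto simp: s_def)
      thus ?thesis using 2 assms
        by (intro disjI1 remove_exchange_old) (auto intro: broom_left)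
    next
      case 3
      hence "s a = m + 1" "s b = m" using assms by (auto simp: s_def)
      thus ?thesis using assms
        by (intro disjI2 remove_exchange_old) (auto intro: broom_step)
    qed
  next
    have "branching (gr N ?H) 2"
      by (rule branchingI[of 0 1 3])
        (use assms in \<open>auto simp: exchange_def broom_left broom_step\<close>)
    moreover have "branching (gr N ?H) (m + 1)"
      by (rule branchingI[of m "m + 2" "N - 1"])
        (use assms in \<open>auto simp: exchange_def broom_step\<close>)
    moreover have "branching (gr N ?H) (N - 2)"
      by (rule branchingI[of "N - 1" N "N - 3"])
        (use assms in \<open>auto simp: exchange_def broom_step broom_right\<close>)
    moreover have "oriented N ?H"
      using assms by (intro oriented_exchange oriented_broom) auto
    moreover have "2 \<noteq> m + 1" "2 \<noteq> N - 2" "m + 1 \<noteq> N - 2" "6 \<le> N" using assms by auto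
    ultimately show "\<not> gr N ?H \<simeq> gr N (broom N)"
      using not_iso_broom_branching by blast
  qed (use assms in \<open>auto simp: broom_def s_def\<close>)
qed

lemma broom_6:
  "broom 6 a b \<longleftrightarrow> (a, b) \<in> {(0, 2), (1, 2), (2, 3), (3, 4), (4, 5), (4, 6)}"
  by (auto simp: broom_def)

text \<open>For \<open>N = 6\<close> the target \<open>k + 2\<close> of the general construction
  would be \<open>N - 2\<close> itself. Instead the leaf moves to \<open>2\<close>, and the second
  card is matched in its mirrored form \<open>(3, 4)\<close>.\<close>

lemma ambiguous_leaf_inner_6: "ambiguous 6 (card_at 6 4 6) (card_at 6 3 4)"
proof (rule ambiguous_exchange[where qx = 2 and qy = 6 and rx = 2 and ry = 3
      and s = "\<lambda>a. if a = 3 then 6 else if a = 6 then 3 else a"])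
  show "\<not> gr 6 (exchange (broom 6) (4, 6) (2, 6)) \<simeq> gr 6 (broom 6)"
    using not_iso_pendant_moved[of 6 2] by simp
qed (auto simp: broom_6 remove_def exchange_def)

text \<open>For \<open>N = 6\<close> the vertices \<open>m + 1\<close> and \<open>N - 2\<close>
  coincide. The competitor is a triangle \<open>0, 1, 2\<close> beside a star with centre
  \<open>4\<close>; any edge of the triangle may be deleted, and only \<open>4\<close> carries
  leaves.\<close>

lemma ambiguous_middle_middle_6: "ambiguous 6 (card_at 6 2 3) (card_at 6 2 3)"
proof (rule ambiguous_exchange[where qx = 0 and qy = 1 and rx = 0 and ry = 2
      and s = "\<lambda>a. if a = 1 then 2 else if a = 2 then 1 else a"])
  let ?R = "exchange (broom 6) (2, 3) (0, 1)"
  show "\<not> gr 6 ?R \<simeq> gr 6 (broom 6)"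
  proof (rule not_iso_broom_cherry[of 6 _ 4])
    show "oriented 6 ?R" by (intro oriented_exchange oriented_broom) auto
    fix x assume "cherry (gr 6 ?R) x"
    then obtain u where "pendant (gr 6 ?R) x u" by (auto simp: cherry_def)
    hence e: "{x, u} \<in> edges (gr 6 ?R)" and l: "\<And>w. {u, w} \<in> edges (gr 6 ?R) \<Longrightarrow> w = x"
      by (auto simp: pendant_def)
    have "u \<noteq> 0" using l[of 1] l[of 2] by (cases "u = 0") (auto simp: exchange_def broom_6)
    moreover have "u \<noteq> 1" using l[of 0] l[of 2] by (cases "u = 1") (auto simp: exchange_def broom_6)
    moreover have "u \<noteq> 2" using l[of 0] l[of 1] by (cases "u = 2") (auto simp: exchange_def broom_6)
    moreover have "u \<noteq> 4" using l[of 3] l[of 5] by (cases "u = 4") (auto simp: exchange_def broom_6)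
    ultimately show "x = 4" using e by (auto simp: exchange_def broom_6)
  qed simp
qed (auto simp: broom_6 remove_def exchange_def)

lemma ambiguous_cards:
  assumes N: "6 \<le> N" "N = 2 * m" and "broom N x y" "broom N x' y'"
  shows "ambiguous N (card_at N x y) (card_at N x' y')"
proof -
  let ?L = "card_at N (N - 2) N" and ?I = "\<lambda>k. card_at N k (k + 1)"
  have s: "simple_graph (card_at N x y)" for x y
    using oriented_broom[of N] N(1) by (intro simple_gr) (auto simp: oriented_def remove_def)
  have refl: "?I (N - 1 - k) \<simeq> ?I k" if "2 \<le> k" "k + 1 \<le> m" for k
  proof -
    have e: "N - 1 - k + 1 = N - k" "N - (N - k) = k" "N - (N - 1 - k) = k + 1"
      using that N by auto
    have "broom N (N - 1 - k) (N - k)" using that N by (intro broom_step) auto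
    thus ?thesis using card_at_reflect[OF N(1)] e by metis
  qed
  have LI: "ambiguous N ?L (?I k)" if k: "2 \<le> k" "k + 1 \<le> m" for k
  proof (cases "k + 5 \<le> N")
    case True
    thus ?thesis using ambiguous_leaf_inner[OF N(1) k(1)] by blast
  next
    case False
    \<comment> \<open>From \<open>k + 1 \<le> m\<close> and \<open>N < k + 5\<close> it follows that
      \<open>m < 4\<close>.\<close>
    hence "N = 6" "k = 2" using N k by auto
    thus ?thesis using ambiguous_iso[OF ambiguous_leaf_inner_6 graph_iso_refl] refl[OF k] by simp
  qed
  \<comment> \<open>The second edge is replaced by its mirror image
    \<open>(N - 1 - l, N - l)\<close> in the right half. If \<open>k + 2 \<le> m\<close>, the two
    positions are then at least two apart, as \<open>ambiguous_inner_inner\<close> demands.\<close>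
  have II': "ambiguous N (?I k) (?I l)" if k: "2 \<le> k" "k + 1 \<le> m" and l: "2 \<le> l" "l + 1 \<le> m"
    and "k + 2 \<le> m" for k l
    using ambiguous_iso[OF ambiguous_inner_inner[OF N(1) k(1)] graph_iso_refl refl[OF l]] that N
    by simp
  have II: "ambiguous N (?I k) (?I l)" if k: "2 \<le> k" "k + 1 \<le> m" and l: "2 \<le> l" "l + 1 \<le> m" for k l
  proof -
    \<comment> \<open>By symmetry of \<open>ambiguous\<close>, only the case where both edges are
      the innermost one remains.\<close>
    consider "k + 2 \<le> m" | "l + 2 \<le> m" | "k = m - 1" "l = m - 1" using k l by linarith
    thus ?thesis
    proof cases
      case 3
      show ?thesis
      proof (cases "4 \<le> m")
        case True
        thus ?thesis using ambiguous_middle_middle[OF _ N(2)] 3 by simp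
      next
        case False
        hence "N = 6" "k = 2" "l = 2" using 3 N by auto
        thus ?thesis using ambiguous_middle_middle_6 by simp
      qed
    qed (use II' ambiguous_sym k l in blast)+
  qed
  have lift: ?thesis
    if "card_at N x y \<simeq> K" "card_at N x' y' \<simeq> K'" "ambiguous N K K'" for K K'
    using ambiguous_iso[OF that(3) graph_iso_sym[OF s that(1)] graph_iso_sym[OF s that(2)]] .
  show ?thesis
    using card_at_cases[OF N assms(3)] card_at_cases[OF N assms(4)]
  proof (elim disjE exE conjE)
    assume "card_at N x y \<simeq> ?L" "card_at N x' y' \<simeq> ?L"
    thus ?thesis using ambiguous_leaf_leaf[OF N(1)] by (rule lift)
  next
    fix k assume k: "card_at N x y \<simeq> ?L" "2 \<le> k" "k + 1 \<le> m" "card_at N x' y' \<simeq> ?I k"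
    show ?thesis using k(1,4) LI[OF k(2,3)] by (rule lift)
  next
    fix k assume k: "card_at N x' y' \<simeq> ?L" "2 \<le> k" "k + 1 \<le> m" "card_at N x y \<simeq> ?I k"
    show ?thesis using k(4,1) ambiguous_sym[OF LI[OF k(2,3)]] by (rule lift)
  next
    fix k l assume kl: "2 \<le> k" "k + 1 \<le> m" "card_at N x y \<simeq> ?I k"
      "2 \<le> l" "l + 1 \<le> m" "card_at N x' y' \<simeq> ?I l"
    show ?thesis using kl(3,6) II[OF kl(1,2,4,5)] by (rule lift)
  qed
qed

lemma not_reconstruct_card_less_3:
  assumes N: "6 \<le> N" "even N" and F: "F \<subseteq> edges (gr N (broom N))" "card F < 3"
  shows "\<not> edge_cards_reconstruct (gr N (broom N)) F"
proof
  assume rec: "edge_cards_reconstruct (gr N (broom N)) F"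
  have "edges (gr N (broom N)) \<subseteq> Pow {..N}"
    using N(1) by (auto simp: gr_def broom_def)
  hence fin: "finite (edges (gr N (broom N)))" by (rule finite_subset) auto
  have "{{1, 2}, {0, 2}} \<subseteq> edges (gr N (broom N))"
    using N(1) by (auto simp: broom_def)
  moreover have "card {{1, 2::nat}, {0, 2}} = 2" by (auto simp: doubleton_eq_iff)
  ultimately have "2 \<le> card (edges (gr N (broom N)))" by (metis card_mono fin)
  \<comment> \<open>A smaller set is enlarged to two edges, which preserves reconstruction.\<close>
  then obtain F' where F': "F \<subseteq> F'" "F' \<subseteq> edges (gr N (broom N))" "card F' = 2"
    using F fin by (metis Suc_leI eval_nat_numeral(3) exists_subset_between less_Suc_eq_le)
  obtain e1 e2 where e: "F' = {e1, e2}" "e1 \<noteq> e2" using F'(3) by (auto simp: card_2_iff)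
  obtain x y x' y' where xy: "e1 = {x, y}" "broom N x y" "e2 = {x', y'}" "broom N x' y'"
    using F'(2) e(1) by (metis edge_grE insert_subset)
  have o: "oriented N (broom N)" using N(1) by (intro oriented_broom) auto
  obtain m where m: "N = 2 * m" using N(2) by blast
  have "ambiguous N (del_edge (gr N (broom N)) e1) (del_edge (gr N (broom N)) e2)"
    using ambiguous_cards[OF N(1) m xy(2,4)] xy o
    by (auto simp: del_edge_remove oriented_def)
  thus False
    using not_reconstruct_ambiguous[OF e(2)] edge_cards_reconstruct_mono[OF rec F'(1)] e(1) by blast
qed

section \<open>Reconstruction from three cards\<close>

definition cut :: "nat \<Rightarrow> 'v ugraph \<Rightarrow> 'v set \<Rightarrow> bool" where
  "cut m K S \<longleftrightarrow> S \<subseteq> verts K \<and> (\<forall>a b. {a, b} \<in> edges K \<longrightarrow> (a \<in> S \<longleftrightarrow> b \<in> S)) \<and>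
     m \<le> card S \<and> m \<le> card (verts K - S) \<and>
     (\<exists>x\<in>S. cherry K x) \<and> (\<exists>x\<in>verts K - S. cherry K x)"

text \<open>The invariant read off from the middle cards. In \<open>cut\<close>, \<open>S\<close> is
  a union of components, with size bounds and a pair of leaves on either side. The clause on
  neighbours excludes isolated vertices, which later forces the detached leaf to be attached
  again.\<close>

definition two_cherried_halves :: "nat \<Rightarrow> 'v ugraph \<Rightarrow> bool" where
  "two_cherried_halves m K \<longleftrightarrow> (\<forall>v\<in>verts K. \<exists>w. {v, w} \<in> edges K) \<and> (\<exists>S. cut m K S)"

text \<open>The conditions are symmetric in the two sides, so the side may be chosen to contain a
  prescribed vertex.\<close>

lemma cut_complement:
  assumes "simple_graph K" "cut m K S"
  shows "cut m K (verts K - S)"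
proof -
  have "verts K - (verts K - S) = S" using assms(2) by (auto simp: cut_def)
  thus ?thesis using assms edge_in_verts[OF assms(1)] by (auto simp: cut_def)
qed

lemma two_cherried_halves_iso:
  assumes s: "simple_graph K" and "K \<simeq> K'" and K: "two_cherried_halves m K"
  shows "two_cherried_halves m K'"
proof -
  obtain \<phi> where iso: "is_iso \<phi> K K'" using assms(2) by (auto simp: graph_iso_iff)
  have img: "verts K' = \<phi> ` verts K" and inj: "inj_on \<phi> (verts K)"
    using iso by (auto simp: is_iso_def bij_betw_def)
  obtain S where "cut m K S" using K by (auto simp: two_cherried_halves_def)
  hence S: "S \<subseteq> verts K" "\<And>a b. {a, b} \<in> edges K \<Longrightarrow> a \<in> S \<longleftrightarrow> b \<in> S"
    "m \<le> card S" "m \<le> card (verts K - S)" "\<exists>x\<in>S. cherry K x" "\<exists>x\<in>verts K - S. cherry K x"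
    by (auto simp: cut_def)
  have diff: "verts K' - \<phi> ` S = \<phi> ` (verts K - S)"
    unfolding img using inj S(1) by (simp add: inj_on_image_set_diff)
  have "cut m K' (\<phi> ` S)"
    unfolding cut_def
  proof (intro conjI allI impI)
    show "\<phi> ` S \<subseteq> verts K'" using S(1) img by auto
    show "m \<le> card (\<phi> ` S)" using S(1,3) inj by (metis card_image inj_on_subset)
    show "m \<le> card (verts K' - \<phi> ` S)"
      unfolding diff using S(4) inj by (metis Diff_subset card_image inj_on_subset)
    show "\<exists>x\<in>\<phi> ` S. cherry K' x" using S(5) cherry_iso[OF s iso] by blast
    show "\<exists>x\<in>verts K' - \<phi> ` S. cherry K' x"
      unfolding diff using S(6) cherry_iso[OF s iso] by blast
  next
    fix a' b' assume ab': "{a', b'} \<in> edges K'"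
    have "simple_graph K'" by (rule is_iso_simple_graph[OF s iso])
    then obtain a where a: "a \<in> verts K" "a' = \<phi> a"
      using edge_in_verts(1)[OF _ ab'] img by auto
    then obtain b where b: "b' = \<phi> b" "{a, b} \<in> edges K"
      using is_iso_edgeD[OF s iso a(1)] ab' by metis
    have "b \<in> verts K" using edge_in_verts[OF s b(2)] by simp
    thus "a' \<in> \<phi> ` S \<longleftrightarrow> b' \<in> \<phi> ` S"
      using S(1) S(2)[OF b(2)] a b(1) inj by (simp add: inj_on_image_mem_iff)
  qed
  moreover have "\<exists>w. {v', w} \<in> edges K'" if "v' \<in> verts K'" for v'
  proof -
    obtain v where v: "v \<in> verts K" "v' = \<phi> v" using \<open>v' \<in> verts K'\<close> img by auto
    then obtain w where "{v, w} \<in> edges K" using K by (auto simp: two_cherried_halves_def)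
    thus ?thesis using is_iso_edge[OF iso] v(2) by blast
  qed
  ultimately show ?thesis unfolding two_cherried_halves_def by blast
qed

lemma broom_ends:
  assumes "5 \<le> N"
  shows "broom N 0 w \<longleftrightarrow> w = 2" "\<not> broom N w 0" "broom N (Suc 0) w \<longleftrightarrow> w = 2" "\<not> broom N w (Suc 0)"
    "broom N w N \<longleftrightarrow> w = N - 2" "\<not> broom N N w" "broom N w (N - Suc 0) \<longleftrightarrow> w = N - 2"
    "\<not> broom N (N - Suc 0) w"
  using assms by (auto simp: broom_def)

text \<open>The sides are \<open>0, ..., k\<close> and \<open>k + 1, ..., N\<close>, with
  \<open>k + 1\<close> and \<open>N - k\<close> vertices. For \<open>N = 2 * m\<close> both middle
  edges, \<open>k = m - 1\<close> and \<open>k = m\<close>, satisfy the bounds.\<close>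

lemma card_at_two_cherried_halves:
  assumes "2 \<le> k" "k + 3 \<le> N" "m \<le> k + 1" "m + k \<le> N"
  shows "two_cherried_halves m (card_at N k (k + 1))"
proof -
  let ?K = "card_at N k (k + 1)"
  have N: "5 \<le> N" using assms by auto
  have p: "pendant ?K 2 0" "pendant ?K 2 1"
    using assms by (simp_all add: pendant_def remove_def broom_ends[OF N])
  have q: "pendant ?K (N - 2) (N - 1)" "pendant ?K (N - 2) N"
    using assms by (simp_all add: pendant_def remove_def broom_ends[OF N])
  have "cherry ?K 2" using p unfolding cherry_def by (metis zero_neq_one)
  moreover have "cherry ?K (N - 2)"
    unfolding cherry_def by (intro exI[of _ "N - 1"] exI[of _ N]) (use q assms in auto)
  moreover have "{..N} - {..k} = {k<..N}" by auto
  moreover have "a \<in> {..k} \<longleftrightarrow> b \<in> {..k}" if "{a, b} \<in> edges ?K" for a b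
    using that assms by (auto simp: remove_def elim!: broom_cases)
  ultimately have "cut m ?K {..k}"
    using assms unfolding cut_def by (auto simp del: edge_gr_iff)
  moreover have "\<exists>w. {v, w} \<in> edges ?K" if v: "v \<in> verts ?K" for v
  proof -
    consider "v = 0" | "v = 1" | "2 \<le> v" "v \<le> k" | "k < v" "v + 2 \<le> N" | "v = N - 1" | "v = N"
      using v by fastforce
    thus ?thesis
    proof cases
      case 3
      hence "{v, v - 1} \<in> edges ?K" using assms by (auto simp: remove_def intro: broom_step)
      thus ?thesis ..
    next
      case 4
      hence "{v, v + 1} \<in> edges ?K" using assms by (auto simp: remove_def intro: broom_step)
      thus ?thesis ..
    qed (use p q in \<open>metis insert_commute pendant_def\<close>)+
  qed
  ultimately show ?thesis unfolding two_cherried_halves_def by blast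
qed

text \<open>Here the leaf \<open>0\<close> has moved from \<open>2\<close> to \<open>v\<close>,
  which leaves the path \<open>1, 2, ...\<close> with no pair of leaves at \<open>2\<close>. The
  side of the cut containing \<open>2\<close> must regain such a pair, and this pins down the
  deleted edge in terms of \<open>v\<close>.\<close>

lemma cut_edge_position:
  fixes N m v p q :: nat
  defines "R \<equiv> exchange (broom N) (0, 2) (0, v)"
  defines "K \<equiv> gr N (remove R (p, q))"
  assumes N: "6 \<le> N" "N = 2 * m" and v: "1 \<le> v" "v \<le> N" "v \<noteq> 2" and pq: "R p q"
    and K: "two_cherried_halves m K"
  shows "q = p + 1 \<and> p + 3 \<le> N \<and> (if v \<le> p then p = v + 1 else p = 3 \<and> m = 3)"
proof -
  have oR: "oriented N R"
    unfolding R_def using v N by (intro oriented_exchange oriented_broom) auto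
  have sK: "simple_graph K" unfolding K_def by (intro simple_gr oriented_remove oR)
  have vK: "verts K = {..N}" by (simp add: K_def)
  obtain S where "cut m K S" using K by (auto simp: two_cherried_halves_def)
  hence "\<exists>L. cut m K L \<and> 2 \<in> L"
    using cut_complement[OF sK, of m S] N vK by (cases "2 \<in> S") auto
  then obtain L where L: "L \<subseteq> {..N}" "m \<le> card L" "m \<le> card ({..N} - L)" "2 \<in> L"
    "\<exists>x\<in>L. cherry K x" and closed: "\<And>a b. {a, b} \<in> edges K \<Longrightarrow> a \<in> L \<longleftrightarrow> b \<in> L"
    unfolding cut_def vK by blast
  have step_edge: "{a, a + 1} \<in> edges K" if "1 \<le> a" "a + 2 \<le> N" "(a, a + 1) \<noteq> (p, q)" for a
    using that broom_step[of a N] by (auto simp: K_def R_def remove_def exchange_def)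
  have right_edge: "{N - 2, N} \<in> edges K" if "(N - 2, N) \<noteq> (p, q)"
    using that broom_right[of N "N - 2"] N by (auto simp: K_def R_def remove_def exchange_def)
  have zero_edge: "{0, v} \<in> edges K" if "(0, v) \<noteq> (p, q)"
    using that by (auto simp: K_def R_def remove_def exchange_def)
  have pos: "q = p + 1 \<and> 2 \<le> p \<and> p + 3 \<le> N"
  proof (rule ccontr)
    \<comment> \<open>Deleting any other edge keeps the whole spine in \<open>L\<close> and
      separates at most one of \<open>1\<close>, \<open>N - 1\<close>, \<open>N\<close> from it.
      Together with \<open>0\<close> the other side has at most two vertices, fewer than
      \<open>m\<close>.\<close>
    assume c: "\<not> ?thesis"
    have spine: "a \<in> L" if "2 \<le> a" "a + 2 \<le> N" for a
      using that
    proof (induction a rule: nat_induct_at_least)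
      case (Suc a)
      hence "(a, a + 1) \<noteq> (p, q)" using c by auto
      hence "{a, a + 1} \<in> edges K" using Suc by (intro step_edge) auto
      thus ?case using closed[of a "a + 1"] Suc by auto
    qed (rule L(4))
    have 1: "1 \<in> L" if "(p, q) \<noteq> (1, 2)"
      using step_edge[of 1, unfolded one_add_one] closed[of 1 2] that L(4) N by auto
    have 2: "N - 1 \<in> L" if "(p, q) \<noteq> (N - 2, N - 1)"
    proof -
      have "{N - 2, N - 2 + 1} \<in> edges K" using that N by (intro step_edge) auto
      moreover have "N - 2 + 1 = N - 1" using N by auto
      ultimately show ?thesis using closed[of "N - 2" "N - 1"] spine[of "N - 2"] N by auto
    qed
    have 3: "N \<in> L" if "(p, q) \<noteq> (N - 2, N)"
      using right_edge closed[of "N - 2" N] that spine[of "N - 2"] N by auto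
    have d: "(1, 2) \<noteq> (N - 2, N - 1)" "(1, 2) \<noteq> (N - 2, N)" "(N - 2, N - 1) \<noteq> (N - 2, N)"
      using N by auto
    have "\<exists>y. {..N} - L \<subseteq> {0, y}"
    proof -
      have sub: "{..N} - L \<subseteq> {0, 1, N - 1, N} - L"
      proof
        fix a assume a: "a \<in> {..N} - L"
        hence "\<not> (2 \<le> a \<and> a + 2 \<le> N)" using spine by auto
        thus "a \<in> {0, 1, N - 1, N} - L" using a by auto
      qed
      consider "N - 1 \<in> L" "N \<in> L" | "1 \<in> L" "N \<in> L" | "1 \<in> L" "N - 1 \<in> L"
        using 1 2 3 d by metis
      thus ?thesis by cases (use sub in blast)+
    qed
    then obtain y where "{..N} - L \<subseteq> {0, y}" by blast
    hence "card ({..N} - L) \<le> card {0, y}" by (intro card_mono) auto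
    also have "\<dots> \<le> 2" by (simp add: card_insert_if)
    finally show False using L(3) N by simp
  qed
  have left: "a \<in> L" if "1 \<le> a" "a \<le> p" for a
  proof (cases "a = 1")
    case True
    have "{1, 2} \<in> edges K" using pos N step_edge[of 1, unfolded one_add_one] by auto
    thus ?thesis using closed[of 1 2] L(4) True by auto
  next
    case False
    hence "2 \<le> a" using that by simp
    thus ?thesis using that(2)
    proof (induction a rule: nat_induct_at_least)
      case (Suc a)
      have "{a, a + 1} \<in> edges K" using Suc pos by (intro step_edge) auto
      thus ?case using closed[of a "a + 1"] Suc by auto
    qed (rule L(4))
  qed
  \<comment> \<open>The vertices beyond \<open>p\<close> all lie on one side. As \<open>m\<close> is
    at least 3, the complement of \<open>L\<close> has a vertex other than \<open>0\<close>; by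
    \<open>left\<close> it is beyond \<open>p\<close>, so all of them are outside
    \<open>L\<close>.\<close>
  have right: "a \<notin> L" if "p < a" "a \<le> N" for a
  proof -
    have same: "b \<in> L \<longleftrightarrow> p + 1 \<in> L" if "p + 1 \<le> b" "b + 1 \<le> N" for b
      using that
    proof (induction b rule: nat_induct_at_least)
      case (Suc b)
      have "{b, b + 1} \<in> edges K" using Suc pos by (intro step_edge) auto
      thus ?case using closed[of b "b + 1"] Suc by auto
    qed simp
    have sameN: "N \<in> L \<longleftrightarrow> p + 1 \<in> L"
    proof -
      have "p + 1 \<le> N - 2" "N - 2 + 1 \<le> N" "(N - 2, N) \<noteq> (p, q)" using pos by auto
      thus ?thesis using right_edge closed[of "N - 2" N] same[of "N - 2"] by blast
    qed
    have all: "b \<in> L \<longleftrightarrow> p + 1 \<in> L" if "p < b" "b \<le> N" for b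
      using same[of b] sameN that by (cases "b = N") auto
    have "\<not> {..N} - L \<subseteq> {0}"
    proof
      assume "{..N} - L \<subseteq> {0}"
      hence "card ({..N} - L) \<le> card {0::nat}" by (intro card_mono) auto
      thus False using L(3) N by simp
    qed
    then obtain b where "b \<le> N" "b \<notin> L" "b \<noteq> 0" by auto
    hence "p < b" using left[of b] by (cases "p < b") auto
    thus ?thesis using all[of b] all[OF that] \<open>b \<le> N\<close> \<open>b \<notin> L\<close> by blast
  qed
  have zero: "0 \<in> L \<longleftrightarrow> v \<le> p"
    using zero_edge closed[of 0 v] left[of v] right[of v] v pos by (cases "v \<le> p") auto
  \<comment> \<open>The side \<open>L\<close> is the path \<open>1, ..., p\<close>, with
    \<open>0\<close> hung at \<open>v\<close> if \<open>v \<le> p\<close>. Its only possible leaves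
    are \<open>0\<close> and the two ends of the path.\<close>
  have leaf: "(u = 0 \<and> v \<le> p \<and> x = v) \<or> (u = 1 \<and> x = 2 \<and> v \<noteq> 1) \<or> (u = p \<and> x = p - 1 \<and> v \<noteq> p)"
    if "x \<in> L" and xu: "pendant K x u" for x u
  proof -
    have l: "w = x" if "{u, w} \<in> edges K" for w using that xu by (auto simp: pendant_def)
    have "u \<in> L" using xu closed[of x u] \<open>x \<in> L\<close> by (auto simp: pendant_def)
    hence "u \<le> p" using right[of u] L(1) by (cases "u \<le> p") auto
    have up: "u + 1 = x" if "1 \<le> u" "u < p"
      using that pos by (intro l step_edge) auto
    have down: "u - 1 = x" if "2 \<le> u"
    proof -
      have "{u - 1, u - 1 + 1} \<in> edges K" using that pos \<open>u \<le> p\<close> by (intro step_edge) auto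
      thus ?thesis using that by (intro l) (auto simp: insert_commute)
    qed
    have z: "x = 0" if "u = v"
      using l[of 0] zero_edge that pos by (auto simp: insert_commute)
    consider "u = 0" | "u = 1" | "2 \<le> u" "u < p" | "u = p" using \<open>u \<le> p\<close> by linarith
    thus ?thesis
    proof cases
      case 1
      thus ?thesis using l[of v] zero_edge zero \<open>u \<in> L\<close> pos by auto
    next
      case 2
      thus ?thesis using up z pos by auto
    next
      case 3
      thus ?thesis using up down by auto
    next
      case 4
      thus ?thesis using down z pos by auto
    qed
  qed
  obtain x a b where x: "x \<in> L" "a \<noteq> b" "pendant K x a" "pendant K x b"
    using L(5) by (auto simp: cherry_def)
  \<comment> \<open>Two of these leaves share a neighbour: \<open>0\<close> and \<open>1\<close>
    would give \<open>v = 2\<close>, \<open>0\<close> and \<open>p\<close> give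
    \<open>p = v + 1\<close>, and \<open>1\<close> and \<open>p\<close> give
    \<open>p = 3\<close>.\<close>
  have "(v \<le> p \<and> p = v + 1) \<or> (p = 3 \<and> v \<noteq> 1 \<and> v \<noteq> 3)"
    using leaf[OF x(1,3)] leaf[OF x(1,4)] x(2) v pos by auto
  \<comment> \<open>Now \<open>0\<close> lies on the other side, so \<open>L\<close> has at most the
    vertices \<open>1, 2, 3\<close>, while it needs at least \<open>m\<close>.\<close>
  moreover have "p = 3 \<and> m = 3" if "p = 3" "\<not> v \<le> p"
  proof -
    have "L \<subseteq> {1, 2, 3}"
    proof
      fix a assume a: "a \<in> L"
      have "a \<le> p" using right[of a] a L(1) by (meson atMost_iff not_le subsetD)
      moreover have "a \<noteq> 0" using zero that(2) a by metis
      ultimately have "a = 1 \<or> a = 2 \<or> a = 3" using that(1) by linarith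
      thus "a \<in> {1, 2, 3}" by blast
    qed
    hence "card L \<le> card {1, 2, 3::nat}" by (intro card_mono) auto
    thus ?thesis using L(2) N that by simp
  qed
  ultimately show ?thesis using pos v by auto
qed

text \<open>The vertex \<open>0\<close> is isolated in the card, so any edge of \<open>H\<close> at
  \<open>0\<close> must be the deleted edge \<open>g\<close>.\<close>

lemma pendant_edge_moved:
  assumes N: "6 \<le> N" and H: "simple_graph H" "g \<in> edges H" "del_edge H g = card_at N 0 2"
    and nbr: "{0, w} \<in> edges H"
  obtains v where "1 \<le> v" "v \<le> N" "g = {0, v}" "H = gr N (exchange (broom N) (0, 2) (0, v))"
proof -
  have V: "verts H = {..N}" and E: "edges H - {g} = edges (card_at N 0 2)"
    using H(3) by (simp_all add: del_edge_def gr_def)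
  have "{0, w} \<notin> edges (card_at N 0 2)" using N by (auto simp: remove_def broom_def)
  hence g: "g = {0, w}" using E nbr by blast
  have w: "w \<le> N" "w \<noteq> 0" using edge_in_verts[OF H(1) nbr] V by auto
  have "edges H = insert {0, w} (edges (card_at N 0 2))" using E g H(2) by blast
  also have "\<dots> = edges (gr N (exchange (broom N) (0, 2) (0, w)))"
    by (auto simp: gr_def remove_def exchange_def)
  finally have "H = gr N (exchange (broom N) (0, 2) (0, w))"
    using V by (simp add: gr_def)
  thus ?thesis using that[of w] w g by auto
qed

lemma reconstruct_three:
  assumes N: "6 \<le> N" "N = 2 * m"
  shows "edge_cards_reconstruct (gr N (broom N)) {{0, 2}, {m - 1, m}, {m, m + 1}}"
  unfolding edge_cards_reconstruct_def
proof (intro allI impI, elim conjE)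
  let ?B = "gr N (broom N)" and ?F = "{{0, 2}, {m - 1, m}, {m, m + 1}}"
  fix H :: "nat ugraph" and f
  assume H: "simple_graph H" and inj: "inj_on f ?F" and f: "f ` ?F \<subseteq> edges H"
    and iso: "\<forall>e\<in>?F. del_edge H (f e) \<simeq> del_edge ?B e"
  have oB: "oriented N (broom N)" using N by (intro oriented_broom) auto
  have "del_edge H (f {0, 2}) \<simeq> card_at N 0 2"
    using iso del_edge_remove[OF oB, of 0 2] by simp
  then obtain \<phi> where \<phi>: "is_iso \<phi> (del_edge H (f {0, 2})) (card_at N 0 2)"
    by (auto simp: graph_iso_iff)
  \<comment> \<open>\<open>H'\<close> is the competitor relabelled along \<open>\<phi>\<close>, so
    that its first card equals \<open>card_at N 0 2\<close> and is not merely isomorphic to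
    it.\<close>
  define H' where "H' = \<lparr>verts = {..N}, edges = (\<lambda>e. \<phi> ` e) ` edges H\<rparr>"
  have H': "is_iso \<phi> H H'"
    using \<phi> by (simp add: is_iso_def H'_def del_edge_def)
  have sH': "simple_graph H'" by (rule is_iso_simple_graph[OF H H'])
  define g where "g = (\<lambda>e. \<phi> ` f e)"
  have g_edge: "g e \<in> edges H'" if "e \<in> ?F" for e
    using f that by (auto simp: g_def H'_def)
  have g_inj: "g e \<noteq> g e'" if "e \<in> ?F" "e' \<in> ?F" "e \<noteq> e'" for e e'
  proof -
    have "f e \<noteq> f e'" using inj_onD[OF inj _ that(1,2)] that(3) by blast
    moreover have "f e \<in> edges H" "f e' \<in> edges H" using f that(1,2) by (meson image_subset_iff)+
    ultimately show ?thesis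
      using inj_onD[OF inj_on_image_edges[OF H H']] unfolding g_def by blast
  qed
  have g_iso: "is_iso \<phi> (del_edge H (f e)) (del_edge H' (g e))" if "e \<in> ?F" for e
    unfolding g_def using f that by (intro is_iso_del_edge[OF H H']) auto
  have gcard: "del_edge H' (g {0, 2}) = card_at N 0 2"
  proof -
    have "edges (del_edge H' (g {0, 2})) = edges (card_at N 0 2)"
      using g_iso[of "{0, 2}"] \<phi> by (simp add: is_iso_def)
    moreover have "verts (del_edge H' (g {0, 2})) = verts (card_at N 0 2)"
      by (simp add: del_edge_def H'_def)
    ultimately show ?thesis by simp
  qed
  have halves: "two_cherried_halves m (del_edge H' (g e))"
    if e: "e = {k, k + 1}" "k = m - 1 \<or> k = m" for e k
  proof -
    have "e \<in> ?F" using e N by auto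
    have "del_edge H (f e) \<simeq> card_at N k (k + 1)"
      using bspec[OF iso \<open>e \<in> ?F\<close>] e(1) del_edge_remove[OF oB, of k "k + 1"] by simp
    hence "card_at N k (k + 1) \<simeq> del_edge H (f e)"
      by (rule graph_iso_sym[OF simple_graph_del_edge[OF H]])
    moreover have "del_edge H (f e) \<simeq> del_edge H' (g e)"
      using g_iso[OF \<open>e \<in> ?F\<close>] by (auto simp: graph_iso_iff)
    moreover have "two_cherried_halves m (card_at N k (k + 1))"
      using e(2) N by (intro card_at_two_cherried_halves) auto
    ultimately show ?thesis
      using two_cherried_halves_iso[OF simple_gr[OF oriented_remove[OF oB]]] graph_iso_trans by blast
  qed
  have "m - 1 + 1 = m" using N by simp
  hence halves1: "two_cherried_halves m (del_edge H' (g {m - 1, m}))"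
    using halves[of "{m - 1, m}" "m - 1"] by simp
  have halves2: "two_cherried_halves m (del_edge H' (g {m, m + 1}))"
    by (rule halves[of _ m]) auto
  \<comment> \<open>A middle card has no isolated vertex, so \<open>0\<close> has a neighbour there
    and hence in \<open>H'\<close>.\<close>
  have "0 \<in> verts (del_edge H' (g {m, m + 1}))" by (simp add: del_edge_def H'_def)
  then obtain w where "{0, w} \<in> edges H'"
    using halves2 unfolding two_cherried_halves_def by (auto simp: del_edge_def)
  then obtain v where v: "1 \<le> v" "v \<le> N" "g {0, 2} = {0, v}"
      and H'v: "H' = gr N (exchange (broom N) (0, 2) (0, v))"
    using pendant_edge_moved[OF N(1) sH' g_edge[of "{0, 2}"] gcard] by auto
  have "v = 2"
  proof (rule ccontr)
    assume "v \<noteq> 2"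
    let ?R = "exchange (broom N) (0, 2) (0, v)"
    have oR: "oriented N ?R" using oB v by (intro oriented_exchange) auto
    have pos: "\<exists>p. g e = {p, p + 1} \<and> p + 3 \<le> N \<and> (if v \<le> p then p = v + 1 else p = 3 \<and> m = 3)"
      if e: "e \<in> ?F" "two_cherried_halves m (del_edge H' (g e))" for e
    proof -
      obtain p q where pq: "g e = {p, q}" "?R p q"
        using g_edge[OF e(1)] unfolding H'v by (rule edge_grE)
      have "p < q" using oR pq(2) by (auto simp: oriented_def)
      hence "del_edge H' (g e) = gr N (remove ?R (p, q))"
        unfolding pq(1) H'v by (rule del_edge_remove[OF oR])
      hence "two_cherried_halves m (gr N (remove ?R (p, q)))" using e(2) by simp
      from cut_edge_position[OF N v(1,2) \<open>v \<noteq> 2\<close> pq(2) this] show ?thesis using pq(1) by auto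
    qed
    obtain p where p: "g {m - 1, m} = {p, p + 1}" "p + 3 \<le> N"
        "if v \<le> p then p = v + 1 else p = 3 \<and> m = 3"
      using pos[OF _ halves1] by auto
    obtain p' where p': "g {m, m + 1} = {p', p' + 1}" "p' + 3 \<le> N"
        "if v \<le> p' then p' = v + 1 else p' = 3 \<and> m = 3"
      using pos[OF _ halves2] by auto
    \<comment> \<open>Both positions are determined by \<open>v\<close>. The two alternatives cannot
      mix: if \<open>m = 3\<close>, the bound \<open>p + 3 \<le> N\<close> gives
      \<open>p \<le> 3\<close>, so one needs \<open>v = 1\<close> and the other
      \<open>v > 3\<close>. But then both cards stem from one edge of \<open>H'\<close>.\<close>
    have "p = p'" using p(2,3) p'(2,3) N by (auto split: if_splits)
    moreover have "{m - 1, m} \<noteq> {m, m + 1}" by (auto simp: doubleton_eq_iff)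
    ultimately show False using g_inj[of "{m - 1, m}" "{m, m + 1}"] p(1) p'(1) by auto
  qed
  hence "exchange (broom N) (0, 2) (0, v) = broom N"
    by (auto simp: exchange_def fun_eq_iff broom_left)
  thus "H \<simeq> ?B" using H' H'v by (auto simp: graph_iso_iff)
qed

lemma ern_broom:
  assumes "6 \<le> N" "even N"
  shows "ern (gr N (broom N)) = 3"
  unfolding ern_def
proof (rule Least_equality)
  obtain m where m: "N = 2 * m" using assms(2) by blast
  let ?F = "{{0, 2}, {m - 1, m}, {m, m + 1}}"
  have "?F \<subseteq> edges (gr N (broom N))"
    using assms(1) m by (auto simp: broom_def)
  moreover have "card ?F = 3" using assms(1) m by (auto simp: doubleton_eq_iff card_insert_if)
  ultimately show "\<exists>F\<subseteq>edges (gr N (broom N)). card F = 3 \<and> edge_cards_reconstruct (gr N (broom N)) F"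
    using reconstruct_three[OF assms(1) m] by blast
  fix k assume "\<exists>F\<subseteq>edges (gr N (broom N)). card F = k \<and> edge_cards_reconstruct (gr N (broom N)) F"
  thus "3 \<le> k" using not_reconstruct_card_less_3[OF assms] not_less by blast
qed

text \<open>A path with more than three vertices contains at most one leaf from each end of the
  broom, hence at most \<open>N - 1\<close> of the \<open>N + 1\<close> vertices.\<close>

lemma tree_diameter_broom:
  assumes "5 \<le> N"
  shows "tree_diameter (gr N (broom N)) = N - 2"
proof -
  let ?G = "gr N (broom N)"
  have bound: "length p \<le> N - 1" if "is_path ?G p" for p
  proof (cases "length p \<le> 3")
    case False
    have p: "distinct p" "set p \<subseteq> {..N}" "\<And>i. Suc i < length p \<Longrightarrow> {p ! i, p ! Suc i} \<in> edges ?G"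
      using that by (auto simp: is_path_def)
    \<comment> \<open>An interior vertex of the path has two distinct neighbours on it, so a vertex
      whose only neighbour is \<open>x\<close> is an end, with \<open>x\<close> next to it.\<close>
    have ends: "(i = 0 \<and> p ! 1 = x) \<or> (Suc i = length p \<and> p ! (length p - 2) = x)"
      if u: "i < length p" and x: "\<And>w. {p ! i, w} \<in> edges ?G \<Longrightarrow> w = x" for i x
    proof -
      have n: "p ! Suc i = x" if "Suc i < length p" using x p(3)[OF that] by blast
      have b: "p ! (i - 1) = x" if "0 < i"
        using x p(3)[of "i - 1"] that u by (metis Suc_diff_1 insert_commute)
      have "\<not> (0 < i \<and> Suc i < length p)"
      proof
        assume i: "0 < i \<and> Suc i < length p"
        hence "p ! (i - 1) = p ! Suc i" using n b by simp
        hence "i - 1 = Suc i" using i p(1) by (subst (asm) nth_eq_iff_index_eq) auto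
        thus False by simp
      qed
      moreover have "i - 1 = length p - 2" if "Suc i = length p" using that by simp
      ultimately show ?thesis using n b u False by (cases "i = 0") auto
    qed
    \<comment> \<open>Two leaves at \<open>x\<close> would occupy both ends, making \<open>x\<close>
      second and last but one at the same time, which forces length 3.\<close>
    have no_twins: "\<not> {a, b} \<subseteq> set p" if "a \<noteq> b"
      and "\<And>w. {a, w} \<in> edges ?G \<Longrightarrow> w = x" "\<And>w. {b, w} \<in> edges ?G \<Longrightarrow> w = x" for a b x
    proof
      assume "{a, b} \<subseteq> set p"
      then obtain i j where ij: "i < length p" "p ! i = a" "j < length p" "p ! j = b"
        by (auto simp: in_set_conv_nth)
      have "(i = 0 \<and> p ! 1 = x) \<or> (Suc i = length p \<and> p ! (length p - 2) = x)"
        "(j = 0 \<and> p ! 1 = x) \<or> (Suc j = length p \<and> p ! (length p - 2) = x)"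
        using ends ij that(2,3) by metis+
      hence "p ! 1 = x \<and> p ! (length p - 2) = x" using ij that(1) by (metis nat.inject)
      hence "p ! 1 = p ! (length p - 2)" by simp
      hence "1 = length p - 2" using False p(1) by (subst (asm) nth_eq_iff_index_eq) auto
      thus False using False by simp
    qed
    have "\<not> {0, 1} \<subseteq> set p"
      by (rule no_twins[of 0 1 2]) (use assms in \<open>auto simp: broom_ends[OF assms]\<close>)
    moreover have "\<not> {N - 1, N} \<subseteq> set p"
      by (rule no_twins[of "N - 1" N "N - 2"]) (use assms in \<open>auto simp: broom_ends[OF assms]\<close>)
    ultimately obtain a b where ab: "a \<in> {0, 1}" "a \<notin> set p" "b \<in> {N - 1, N}" "b \<notin> set p" by blast
    have "a \<noteq> b" "a \<le> N" "b \<le> N" using ab assms by auto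
    have "set p \<subseteq> {..N} - {a, b}" using p(2) ab by auto
    hence "card (set p) \<le> card ({..N} - {a, b})" by (intro card_mono) auto
    also have "\<dots> = N - 1" using \<open>a \<noteq> b\<close> \<open>a \<le> N\<close> \<open>b \<le> N\<close> by (subst card_Diff_subset) auto
    finally show ?thesis using p(1) by (simp add: distinct_card)
  qed (use assms in auto)
  \<comment> \<open>The bound is attained by the spine with one leaf added at each end.\<close>
  have "is_path ?G [1..<N]"
    using assms by (auto simp: is_path_def intro: broom_step)
  hence "N - 2 \<in> {length p - 1 |p. is_path ?G p}" by force
  moreover have "l \<le> N - 2" if "l \<in> {length p - 1 |p. is_path ?G p}" for l
    using that bound by force
  moreover from this have "finite {length p - 1 |p. is_path ?G p}"
    by (meson finite_nat_set_iff_bounded_le)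
  ultimately show ?thesis unfolding tree_diameter_def by (intro Max_eqI) auto
qed

section \<open>Numbering an arbitrary caterpillar\<close>

lemma leaf_edge_unique:
  assumes "u \<in> leaves G" "e \<in> edges G" "u \<in> e" "e' \<in> edges G" "u \<in> e'"
  shows "e = e'"
proof -
  have "card {e \<in> edges G. u \<in> e} = 1" using assms(1) by (simp add: leaves_def degree_def)
  then obtain x where x: "{e \<in> edges G. u \<in> e} = {x}" by (metis card_1_singletonE)
  have "e \<in> {x}" "e' \<in> {x}" unfolding x[symmetric] using assms by simp_all
  thus ?thesis by simp
qed

text \<open>Two adjacent leaves form a component of their own: a path starting in \<open>u\<close>
  never leaves \<open>{u, w}\<close>, so it cannot reach the non-leaf \<open>x\<close>.\<close>

lemma no_leaf_leaf_edge:
  assumes "connected_graph G" "x \<in> verts G - leaves G" "u \<in> leaves G" "w \<in> leaves G"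
  shows "{u, w} \<notin> edges G"
proof
  assume uw: "{u, w} \<in> edges G"
  have "u \<in> verts G" using assms(3) by (simp add: leaves_def)
  then obtain p where p: "is_path G p" "hd p = u" "last p = x"
    using assms(1,2) by (auto simp: connected_graph_def)
  have ne: "p \<noteq> []" using p(1) by (simp add: is_path_def)
  have "p ! i \<in> {u, w}" if "i < length p" for i
    using that
  proof (induction i)
    case 0
    thus ?case using p(2) ne by (simp add: hd_conv_nth)
  next
    case (Suc i)
    have "{p ! i, p ! Suc i} \<in> edges G" using p(1) Suc.prems by (simp add: is_path_def)
    moreover have "p ! i \<in> {u, w}" using Suc by simp
    ultimately have "{p ! i, p ! Suc i} = {u, w}"
      using leaf_edge_unique[of "p ! i" G "{p ! i, p ! Suc i}" "{u, w}"] uw assms(3,4) by blast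
    thus ?case by blast
  qed
  hence "x \<in> {u, w}" using p(3) ne by (metis diff_less last_conv_nth length_greater_0_conv zero_less_one)
  thus False using assms(2-4) by blast
qed

lemma caterpillar_iso_broom:
  assumes "is_caterpillar C (2 # replicate n 0 @ [2])"
  shows "C \<simeq> gr (n + 5) (broom (n + 5))"
proof -
  let ?as = "2 # replicate n 0 @ [2::nat]" and ?L = "leaves C"
  have C: "simple_graph C" "connected_graph C"
    using assms by (auto simp: is_caterpillar_def is_tree_def)
  obtain vs where vs: "is_spine C vs" "length vs = n + 2"
    and as: "\<And>i. i < n + 2 \<Longrightarrow> card {u \<in> ?L. {vs ! i, u} \<in> edges C} = ?as ! i"
    using assms by (auto simp: is_caterpillar_def)
  define A where "A = {u \<in> ?L. {vs ! 0, u} \<in> edges C}"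
  define B where "B = {u \<in> ?L. {vs ! (n + 1), u} \<in> edges C}"
  have finL: "finite ?L" using C(1) by (auto simp: leaves_def simple_graph_def)
  have dist: "distinct vs" and V: "verts C - ?L = set vs"
    and sp: "{e \<in> edges C. e \<inter> ?L = {}} = {{vs ! i, vs ! Suc i} | i. Suc i < length vs}"
    using vs(1) by (auto simp: is_spine_def del_verts_def path_graph_def)
  have vsL: "vs ! i \<in> verts C - ?L" if "i < n + 2" for i
    unfolding V using that vs(2) by simp
  have "card A = 2" unfolding A_def using as[of 0] by simp
  then obtain a0 a1 where a: "A = {a0, a1}" "a0 \<noteq> a1" by (auto simp: card_2_iff)
  have "card B = 2" unfolding B_def using as[of "n + 1"] by (simp add: nth_append)
  then obtain b0 b1 where b: "B = {b0, b1}" "b0 \<noteq> b1" by (auto simp: card_2_iff)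
  have mid: "{vs ! i, u} \<notin> edges C" if "u \<in> ?L" "0 < i" "i < n + 1" for i u
  proof -
    have "card {u \<in> ?L. {vs ! i, u} \<in> edges C} = 0"
      using as[of i] that by (auto simp: nth_Cons' nth_append)
    thus ?thesis using that(1) finL by auto
  qed
  \<comment> \<open>The other end of the edge is no leaf, so it lies on the spine; the zero entries
    leave only the two ends of the spine.\<close>
  have leaf_edge: "(u \<in> A \<and> e = {vs ! 0, u}) \<or> (u \<in> B \<and> e = {vs ! (n + 1), u})"
    if e: "e \<in> edges C" "u \<in> e" "u \<in> ?L" for e u
  proof -
    obtain x where x: "e = {x, u}" "x \<in> verts C"
      using simple_graph_edgeE[OF C(1) e(1)] e(2) by (metis insertE insert_commute singletonD)
    have "x \<notin> ?L"
      using no_leaf_leaf_edge[OF C(2) vsL[of 0] _ e(3)] e(1) x(1) by auto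
    hence "x \<in> set vs" using x(2) V by blast
    then obtain i where i: "i < n + 2" "x = vs ! i" using vs(2) by (auto simp: in_set_conv_nth)
    have "i = 0 \<or> i = n + 1" using mid[OF e(3), of i] e(1) x(1) i by force
    thus ?thesis using e x(1) i(2) by (auto simp: A_def B_def)
  qed
  have leaf_ex: "\<exists>e\<in>edges C. u \<in> e" if "u \<in> ?L" for u
  proof -
    have "card {e \<in> edges C. u \<in> e} \<noteq> 0" using that by (simp add: leaves_def degree_def)
    hence "{e \<in> edges C. u \<in> e} \<noteq> {}" by (metis card.empty)
    thus ?thesis by blast
  qed
  have LAB: "?L = A \<union> B"
    using leaf_edge leaf_ex by (auto simp: A_def B_def) blast
  have disj: "A \<inter> B = {}"
  proof (rule ccontr)
    assume "A \<inter> B \<noteq> {}"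
    then obtain u where u: "u \<in> A" "u \<in> B" by blast
    hence "{vs ! 0, u} = {vs ! (n + 1), u}"
      unfolding A_def B_def by (intro leaf_edge_unique[of u C]) auto
    moreover have "vs ! 0 \<noteq> vs ! (n + 1)" using dist vs(2) by (simp add: nth_eq_iff_index_eq)
    moreover have "vs ! 0 \<noteq> u" "vs ! (n + 1) \<noteq> u" using vsL[of 0] vsL[of "n + 1"] u by (auto simp: A_def)
    ultimately show False by (auto simp: doubleton_eq_iff)
  qed
  \<comment> \<open>The vertices in the order of their labels \<open>0, ..., n + 5\<close>; the
    spine vertex \<open>vs ! i\<close> receives label \<open>i + 2\<close>.\<close>
  define xs where "xs = [a0, a1] @ vs @ [b0, b1]"
  have len: "length xs = n + 6" by (simp add: xs_def vs(2))
  have "distinct xs"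
    using dist disj a b V LAB unfolding xs_def by auto
  moreover have "set xs = verts C"
  proof -
    have "?L \<subseteq> verts C" by (auto simp: leaves_def)
    thus ?thesis using V LAB a(1) b(1) unfolding xs_def by auto
  qed
  moreover have "{..n + 5} = {..<n + 6}" by auto
  ultimately have bij: "bij_betw (\<lambda>i. xs ! i) {..n + 5} (verts C)"
    using len by (metis bij_betw_nth)
  have nth: "xs ! 0 = a0" "xs ! 1 = a1" "xs ! (n + 4) = b0" "xs ! (n + 5) = b1"
    "\<And>i. i < n + 2 \<Longrightarrow> xs ! (i + 2) = vs ! i"
    by (simp_all add: xs_def nth_append vs(2))
  have nth': "xs ! 2 = vs ! 0" "xs ! (n + 3) = vs ! (n + 1)"
    using nth(5)[of 0] nth(5)[of "n + 1"] by (simp_all add: eval_nat_numeral)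
  have edges_eq: "edges C = (\<lambda>e. (\<lambda>i. xs ! i) ` e) ` edges (gr (n + 5) (broom (n + 5)))"
  proof (intro equalityI subsetI)
    fix e assume e: "e \<in> edges C"
    have img: "e \<in> (\<lambda>e. (\<lambda>i. xs ! i) ` e) ` edges (gr (n + 5) (broom (n + 5)))"
      if "e = {xs ! i, xs ! j}" "broom (n + 5) i j" for i j
    proof (rule image_eqI)
      show "e = (\<lambda>i. xs ! i) ` {i, j}" using that(1) by simp
      show "{i, j} \<in> edges (gr (n + 5) (broom (n + 5)))" using that(2) by simp
    qed
    show "e \<in> (\<lambda>e. (\<lambda>i. xs ! i) ` e) ` edges (gr (n + 5) (broom (n + 5)))"
    proof (cases "e \<inter> ?L = {}")
      case True
      hence "e \<in> {e \<in> edges C. e \<inter> ?L = {}}" using e by simp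
      then obtain i where i: "e = {vs ! i, vs ! Suc i}" "Suc i < n + 2"
        unfolding sp vs(2) by (elim CollectE exE conjE)
      have "vs ! i = xs ! (i + 2)" "vs ! Suc i = xs ! (Suc i + 2)"
        using nth(5)[of i] nth(5)[of "Suc i"] i(2) by simp_all
      hence "e = {xs ! (i + 2), xs ! (Suc i + 2)}" using i(1) by metis
      moreover have "broom (n + 5) (i + 2) (Suc i + 2)" using i(2) by (intro broom_step) auto
      ultimately show ?thesis by (rule img)
    next
      case False
      then obtain u where u: "u \<in> e" "u \<in> ?L" by blast
      consider "e = {vs ! 0, a0}" | "e = {vs ! 0, a1}" | "e = {vs ! (n + 1), b0}" | "e = {vs ! (n + 1), b1}"
        using leaf_edge[OF e u] a(1) b(1) by blast
      thus ?thesis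
      proof cases
        case 1
        thus ?thesis using nth nth' by (intro img[of 0 2] broom_left) auto
      next
        case 2
        thus ?thesis using nth nth' by (intro img[of 1 2] broom_step) auto
      next
        case 3
        thus ?thesis using nth nth' by (intro img[of "n + 3" "n + 4"] broom_step) auto
      next
        case 4
        thus ?thesis using nth nth' by (intro img[of "n + 3" "n + 5"] broom_right) auto
      qed
    qed
  next
    fix e assume "e \<in> (\<lambda>e. (\<lambda>i. xs ! i) ` e) ` edges (gr (n + 5) (broom (n + 5)))"
    then obtain i j where e: "e = {xs ! i, xs ! j}" and ij: "broom (n + 5) i j"
      by (auto elim!: edge_grE)
    have "a0 \<in> A" "a1 \<in> A" "b0 \<in> B" "b1 \<in> B" using a b by auto
    hence ends: "{xs ! 0, xs ! 2} \<in> edges C" "{xs ! 1, xs ! 2} \<in> edges C"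
      "{xs ! (n + 3), xs ! (n + 4)} \<in> edges C" "{xs ! (n + 3), xs ! (n + 5)} \<in> edges C"
      unfolding nth nth' by (auto simp: A_def B_def insert_commute)
    have spine: "{xs ! (k + 2), xs ! (k + 3)} \<in> edges C" if "k < n + 1" for k
    proof -
      have "{vs ! k, vs ! Suc k} \<in> {e \<in> edges C. e \<inter> ?L = {}}"
        unfolding sp using that vs(2) by auto
      thus ?thesis using nth(5)[of k] nth(5)[of "Suc k"] that by (simp add: eval_nat_numeral)
    qed
    from ij show "e \<in> edges C"
    proof (cases rule: broom_cases)
      case 1
      then consider "i = 1" | "i = n + 3" | "2 \<le> i" "i < n + 3" by linarith
      thus ?thesis
      proof cases
        case 1
        thus ?thesis using ends(2) e \<open>j = i + 1\<close> by (simp add: numeral_2_eq_2)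
      next
        case 2
        thus ?thesis using ends(3) e \<open>j = i + 1\<close> by (simp add: eval_nat_numeral)
      next
        case 3
        have "i = i - 2 + 2" "j = i - 2 + 3" "i - 2 < n + 1"
          using 3 \<open>j = i + 1\<close> by linarith+
        thus ?thesis using spine[of "i - 2"] e by metis
      qed
    next
      case 2
      thus ?thesis using ends(1) e by simp
    next
      case 3
      hence "i = n + 3" "j = n + 5" by auto
      thus ?thesis using ends(4) e by simp
    qed
  qed
  have "is_iso (\<lambda>i. xs ! i) (gr (n + 5) (broom (n + 5))) C"
    unfolding is_iso_def verts_gr using bij edges_eq by (rule conjI)
  hence "gr (n + 5) (broom (n + 5)) \<simeq> C"
    unfolding graph_iso_iff by blast
  thus ?thesis
    by (rule graph_iso_sym[rotated]) (rule simple_gr[OF oriented_broom], simp)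
qed

theorem theorem4p2:
  fixes C :: "'v ugraph" and d n :: nat
  assumes "d > 3" and "even d"
    and "is_caterpillar C (2 # replicate n 0 @ [2])"
    and "tree_diameter C = d"
  shows "ern C = 3"
proof -
  let ?B = "gr (n + 5) (broom (n + 5))"
  have s: "simple_graph C" using assms(3) by (simp add: is_caterpillar_def is_tree_def)
  have iso: "C \<simeq> ?B" by (rule caterpillar_iso_broom[OF assms(3)])
  \<comment> \<open>With \<open>N = n + 5\<close> the diameter is \<open>N - 2\<close>, so the size
    and parity of \<open>d\<close> carry over to \<open>N\<close>.\<close>
  have "d = n + 3"
    using tree_diameter_iso[OF s iso] tree_diameter_broom[of "n + 5"] assms(4) by simp
  hence "6 \<le> n + 5" "even (n + 5)" using assms(1,2) by auto
  thus ?thesis using ern_iso[OF s iso] ern_broom by simp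
qed
end
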